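(* Let $k$ be an algebraically closed field, let $n \geq 2$ be an integer, and let $Q_1, Q_2, \ldots, Q_n$ be finite, connected, acyclic quivers. Then the category $Rep_{(Q_1,Q_2,\ldots,Q_n)}$ of $n$-representations of $(Q_1,\ldots,Q_n)$ over $k$ is a $k$-linear abelian category.
   Context: For $m\in\{1,\ldots,n\}$ write $Q_m=(\mathsf{Q}^{(m)}_0,\mathsf{Q}^{(m)}_1,s,t)$, with vertex set $\mathsf{Q}^{(m)}_0$, arrow set $\mathsf{Q}^{(m)}_1$, and source and target maps $s,t:\mathsf{Q}^{(m)}_1\to\mathsf{Q}^{(m)}_0$. For a quiver $Q$, $Rep_k(Q)$ denotes the category of $k$-linear representations of $Q$ (a $k$-vector space $M_i$ for each vertex $i$, of arbitrary dimension, and a $k$-linear map $M_{s(\alpha)}\to M_{t(\alpha)}$ for each arrow $\alpha$; morphisms are families of linear maps, one per vertex, commuting with the arrow maps). An $n$-representation of $(Q_1,\ldots,Q_n)$ is a $(2n-1)$-tuple $\bar V=(V^{(1)},\ldots,V^{(n)},\psi_2,\ldots,\psi_n)$, where $V^{(m)}\in Rep_k(Q_m)$ for each $m\in\{1,\ldots,n\}$ and, for each $m\in\{2,\ldots,n\}$, $\psi_m$ is a collection of $k$-linear maps $$\psi_{m,\gamma}^{\gamma'}:V^{(m-1)}_{t(\gamma)}\to V^{(m)}_{s(\gamma')},$$ one for each pair of arrows $(\gamma,\gamma')\in \mathsf{Q}^{(m-1)}_1\times\mathsf{Q}^{(m)}_1$. No compatibility between the $\psi_m$ and the arrow maps is required.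 A morphism from $\bar V$ to $\bar W=(W^{(1)},\ldots,W^{(n)},\psi'_2,\ldots,\psi'_n)$ is an $n$-tuple $(f^{(1)},\ldots,f^{(n)})$, where $f^{(m)}:V^{(m)}\to W^{(m)}$ is a morphism in $Rep_k(Q_m)$ for each $m$, such that for each $m\in\{2,\ldots,n\}$ and each $(\gamma,\gamma')\in \mathsf{Q}^{(m-1)}_1\times\mathsf{Q}^{(m)}_1$, $$f^{(m)}_{s(\gamma')}\circ\psi_{m,\gamma}^{\gamma'}={\psi'}_{m,\gamma}^{\gamma'}\circ f^{(m-1)}_{t(\gamma)}.$$ Composition, identities, addition and scalar multiplication of morphisms are componentwise. This defines the category $Rep_{(Q_1,\ldots,Q_n)}$. An additive category is one whose hom sets are abelian groups with biadditive composition, that has a zero object, and that has direct sums of any two objects. It is $k$-linear if its hom sets are $k$-vector spaces with $k$-bilinear composition. An abelian category is an additive category in which every morphism $f:X\to Y$ has a canonical decomposition, i.e. a sequence $K\xrightarrow{\kappa}X\xrightarrow{\iota}I\xrightarrow{j}Y\xrightarrow{c}C$ such that $j\iota=f$, $(K,\kappa)=\mathrm{Ker}(f)$, $(C,c)=\mathrm{Coker}(f)$, $(I,\iota)=\mathrm{Coker}(\kappa)$, and $(I,j)=\mathrm{Ker}(c)$. *)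

theory Defs
  imports
    "HOL-Algebra.Algebraic_Closure"
    "Graph_Theory.Digraph_Component"
    "Graph_Theory.Arc_Walk"
begin

section \<open>Additive, linear and abelian categories\<close>

text \<open>
  Hom sets are indexed by source and target and need not be disjoint; accordingly composition
  and identities take the objects as arguments: \<open>Cmp C A B D g f\<close> is the composite
  $g \circ f$ of $f : A \to B$ and $g : B \to D$.  Each \<open>Hom C A B\<close> is an HOL-Algebra
  module record, so that it carries its addition, zero and scalar multiplication; the fields
  for a ring multiplication that such a record also has are never used.  Only
  \<open>klinear_category\<close> refers to the scalar multiplication.
\<close>

record ('k, 'o, 'm) category_data =
  Obj :: "'o set"
  Hom :: "'o \<Rightarrow> 'o \<Rightarrow> ('k, 'm) module"
  Cmp :: "'o \<Rightarrow> 'o \<Rightarrow> 'o \<Rightarrow> 'm \<Rightarrow> 'm \<Rightarrow> 'm"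
  Idn :: "'o \<Rightarrow> 'm"

locale category =
  fixes C :: "('k, 'o, 'm) category_data"
  assumes Cmp_closed:
      "\<lbrakk>A \<in> Obj C; B \<in> Obj C; D \<in> Obj C; f \<in> carrier (Hom C A B); g \<in> carrier (Hom C B D)\<rbrakk>
        \<Longrightarrow> Cmp C A B D g f \<in> carrier (Hom C A D)"
    and Cmp_assoc:
      "\<lbrakk>A \<in> Obj C; B \<in> Obj C; D \<in> Obj C; E \<in> Obj C;
        f \<in> carrier (Hom C A B); g \<in> carrier (Hom C B D); h \<in> carrier (Hom C D E)\<rbrakk>
        \<Longrightarrow> Cmp C A B E (Cmp C B D E h g) f = Cmp C A D E h (Cmp C A B D g f)"
    and Idn_closed: "A \<in> Obj C \<Longrightarrow> Idn C A \<in> carrier (Hom C A A)"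
    and Cmp_Idn_left:
      "\<lbrakk>A \<in> Obj C; B \<in> Obj C; f \<in> carrier (Hom C A B)\<rbrakk> \<Longrightarrow> Cmp C A B B (Idn C B) f = f"
    and Cmp_Idn_right:
      "\<lbrakk>A \<in> Obj C; B \<in> Obj C; f \<in> carrier (Hom C A B)\<rbrakk> \<Longrightarrow> Cmp C A A B f (Idn C A) = f"

definition is_zero_object :: "('k, 'o, 'm) category_data \<Rightarrow> 'o \<Rightarrow> bool" where
  "is_zero_object C Z \<longleftrightarrow> Z \<in> Obj C \<and>
     (\<forall>A \<in> Obj C. (\<exists>!f. f \<in> carrier (Hom C Z A)) \<and> (\<exists>!f. f \<in> carrier (Hom C A Z)))"

definition is_direct_sum ::
  "('k, 'o, 'm) category_data \<Rightarrow> 'o \<Rightarrow> 'o \<Rightarrow> 'o \<Rightarrow> 'm \<Rightarrow> 'm \<Rightarrow> 'm \<Rightarrow> 'm \<Rightarrow> bool" where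
  "is_direct_sum C A B S i\<^sub>1 i\<^sub>2 p\<^sub>1 p\<^sub>2 \<longleftrightarrow> S \<in> Obj C \<and>
     i\<^sub>1 \<in> carrier (Hom C A S) \<and> i\<^sub>2 \<in> carrier (Hom C B S) \<and>
     p\<^sub>1 \<in> carrier (Hom C S A) \<and> p\<^sub>2 \<in> carrier (Hom C S B) \<and>
     Cmp C A S A p\<^sub>1 i\<^sub>1 = Idn C A \<and> Cmp C B S B p\<^sub>2 i\<^sub>2 = Idn C B \<and>
     Cmp C A S B p\<^sub>2 i\<^sub>1 = \<zero>\<^bsub>Hom C A B\<^esub> \<and> Cmp C B S A p\<^sub>1 i\<^sub>2 = \<zero>\<^bsub>Hom C B A\<^esub> \<and>
     Cmp C S A S i\<^sub>1 p\<^sub>1 \<oplus>\<^bsub>Hom C S S\<^esub> Cmp C S B S i\<^sub>2 p\<^sub>2 = Idn C S"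

definition is_kernel ::
  "('k, 'o, 'm) category_data \<Rightarrow> 'o \<Rightarrow> 'o \<Rightarrow> 'm \<Rightarrow> 'o \<Rightarrow> 'm \<Rightarrow> bool" where
  "is_kernel C A B f K \<kappa> \<longleftrightarrow> K \<in> Obj C \<and> \<kappa> \<in> carrier (Hom C K A) \<and>
     Cmp C K A B f \<kappa> = \<zero>\<^bsub>Hom C K B\<^esub> \<and>
     (\<forall>T \<in> Obj C. \<forall>g \<in> carrier (Hom C T A). Cmp C T A B f g = \<zero>\<^bsub>Hom C T B\<^esub> \<longrightarrow>
        (\<exists>!u. u \<in> carrier (Hom C T K) \<and> Cmp C T K A \<kappa> u = g))"

definition is_cokernel ::
  "('k, 'o, 'm) category_data \<Rightarrow> 'o \<Rightarrow> 'o \<Rightarrow> 'm \<Rightarrow> 'o \<Rightarrow> 'm \<Rightarrow> bool" where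
  "is_cokernel C A B f D c \<longleftrightarrow> D \<in> Obj C \<and> c \<in> carrier (Hom C B D) \<and>
     Cmp C A B D c f = \<zero>\<^bsub>Hom C A D\<^esub> \<and>
     (\<forall>T \<in> Obj C. \<forall>g \<in> carrier (Hom C B T). Cmp C A B T g f = \<zero>\<^bsub>Hom C A T\<^esub> \<longrightarrow>
        (\<exists>!u. u \<in> carrier (Hom C D T) \<and> Cmp C B D T u c = g))"

locale additive_category = category C for C :: "('k, 'o, 'm) category_data" +
  assumes Hom_abelian_group: "\<lbrakk>A \<in> Obj C; B \<in> Obj C\<rbrakk> \<Longrightarrow> abelian_group (Hom C A B)"
    and Cmp_add_left:
      "\<lbrakk>A \<in> Obj C; B \<in> Obj C; D \<in> Obj C; f \<in> carrier (Hom C A B);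
        g \<in> carrier (Hom C B D); g' \<in> carrier (Hom C B D)\<rbrakk>
        \<Longrightarrow> Cmp C A B D (g \<oplus>\<^bsub>Hom C B D\<^esub> g') f = Cmp C A B D g f \<oplus>\<^bsub>Hom C A D\<^esub> Cmp C A B D g' f"
    and Cmp_add_right:
      "\<lbrakk>A \<in> Obj C; B \<in> Obj C; D \<in> Obj C; f \<in> carrier (Hom C A B);
        f' \<in> carrier (Hom C A B); g \<in> carrier (Hom C B D)\<rbrakk>
        \<Longrightarrow> Cmp C A B D g (f \<oplus>\<^bsub>Hom C A B\<^esub> f') = Cmp C A B D g f \<oplus>\<^bsub>Hom C A D\<^esub> Cmp C A B D g f'"
    and ex_zero_object: "\<exists>D. is_zero_object C D"
    and ex_direct_sum:
      "\<lbrakk>A \<in> Obj C; B \<in> Obj C\<rbrakk> \<Longrightarrow> \<exists>S i\<^sub>1 i\<^sub>2 p\<^sub>1 p\<^sub>2. is_direct_sum C A B S i\<^sub>1 i\<^sub>2 p\<^sub>1 p\<^sub>2"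

locale klinear_category = additive_category C + field k
  for k :: "('k, 'r) ring_scheme" and C :: "('k, 'o, 'm) category_data" +
  assumes Hom_module: "\<lbrakk>A \<in> Obj C; B \<in> Obj C\<rbrakk> \<Longrightarrow> module k (Hom C A B)"
    and Cmp_smult_left:
      "\<lbrakk>A \<in> Obj C; B \<in> Obj C; D \<in> Obj C; a \<in> carrier k;
        f \<in> carrier (Hom C A B); g \<in> carrier (Hom C B D)\<rbrakk>
        \<Longrightarrow> Cmp C A B D (a \<odot>\<^bsub>Hom C B D\<^esub> g) f = a \<odot>\<^bsub>Hom C A D\<^esub> Cmp C A B D g f"
    and Cmp_smult_right:
      "\<lbrakk>A \<in> Obj C; B \<in> Obj C; D \<in> Obj C; a \<in> carrier k;
        f \<in> carrier (Hom C A B); g \<in> carrier (Hom C B D)\<rbrakk>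
        \<Longrightarrow> Cmp C A B D g (a \<odot>\<^bsub>Hom C A B\<^esub> f) = a \<odot>\<^bsub>Hom C A D\<^esub> Cmp C A B D g f"

definition has_canonical_decomposition ::
  "('k, 'o, 'm) category_data \<Rightarrow> 'o \<Rightarrow> 'o \<Rightarrow> 'm \<Rightarrow> bool" where
  "has_canonical_decomposition C A B f \<longleftrightarrow>
     (\<exists>K \<kappa> I \<iota> j D c.
        is_kernel C A B f K \<kappa> \<and> is_cokernel C A B f D c \<and>
        is_cokernel C K A \<kappa> I \<iota> \<and> is_kernel C B D c I j \<and>
        Cmp C A I B j \<iota> = f)"

locale abelian_category = additive_category C for C :: "('k, 'o, 'm) category_data" +
  assumes canonical_decomposition:
    "\<lbrakk>A \<in> Obj C; B \<in> Obj C; f \<in> carrier (Hom C A B)\<rbrakk> \<Longrightarrow> has_canonical_decomposition C A B f"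


section \<open>Representations of a quiver\<close>

text \<open>
  A quiver is a directed multigraph \<^typ>\<open>('q, 'a) pre_digraph\<close>, with \<^const>\<open>tail\<close> as source
  and \<^const>\<open>head\<close> as target map.  The library's \<^const>\<open>pre_digraph.cycle\<close> counts loops as
  cycles, and its notion of connectedness is that of the underlying undirected graph and
  excludes the empty graph.
\<close>

definition finite_connected_acyclic :: "('q, 'a) pre_digraph \<Rightarrow> bool" where
  "finite_connected_acyclic Q \<longleftrightarrow>
     fin_digraph Q \<and> Digraph_Component.connected Q \<and> (\<nexists>p. pre_digraph.cycle Q p)"

text \<open>
  A $k$-vector space is an HOL-Algebra module over the field \<open>k\<close> whose carrier is a subset of
  the type \<open>'v\<close>; no dimension is bounded except through the size of \<open>'v\<close>, which remains an
  arbitrary type.  Linear maps, and all families below, are extensional functions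
  (\<^const>\<open>undefined\<close> outside the domain), so that HOL equality is equality of maps and families.
\<close>

definition linear_maps ::
  "('k, 'r) ring_scheme \<Rightarrow> ('k, 'v) module \<Rightarrow> ('k, 'v) module \<Rightarrow> ('v \<Rightarrow> 'v) set" where
  "linear_maps k M N =
     {f \<in> carrier M \<rightarrow>\<^sub>E carrier N.
        (\<forall>x \<in> carrier M. \<forall>y \<in> carrier M. f (x \<oplus>\<^bsub>M\<^esub> y) = f x \<oplus>\<^bsub>N\<^esub> f y) \<and>
        (\<forall>a \<in> carrier k. \<forall>x \<in> carrier M. f (a \<odot>\<^bsub>M\<^esub> x) = a \<odot>\<^bsub>N\<^esub> f x)}"

record ('k, 'v, 'q, 'a) qrep =
  space :: "'q \<Rightarrow> ('k, 'v) module"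
  arrow_map :: "'a \<Rightarrow> 'v \<Rightarrow> 'v"

definition qreps ::
  "('k, 'r) ring_scheme \<Rightarrow> ('q, 'a) pre_digraph \<Rightarrow> ('k, 'v, 'q, 'a) qrep set" where
  "qreps k Q =
     {V. space V \<in> verts Q \<rightarrow>\<^sub>E {M. module k M} \<and>
         arrow_map V \<in>
           (\<Pi>\<^sub>E \<alpha> \<in> arcs Q. linear_maps k (space V (tail Q \<alpha>)) (space V (head Q \<alpha>)))}"

definition qrep_hom ::
  "('k, 'r) ring_scheme \<Rightarrow> ('q, 'a) pre_digraph \<Rightarrow>
   ('k, 'v, 'q, 'a) qrep \<Rightarrow> ('k, 'v, 'q, 'a) qrep \<Rightarrow> ('q \<Rightarrow> 'v \<Rightarrow> 'v) set" where
  "qrep_hom k Q V W =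
     {f \<in> (\<Pi>\<^sub>E i \<in> verts Q. linear_maps k (space V i) (space W i)).
        \<forall>\<alpha> \<in> arcs Q.
          compose (carrier (space V (tail Q \<alpha>))) (f (head Q \<alpha>)) (arrow_map V \<alpha>) =
          compose (carrier (space V (tail Q \<alpha>))) (arrow_map W \<alpha>) (f (tail Q \<alpha>))}"


section \<open>The category of n-representations\<close>

text \<open>
  The quivers $Q_1, \ldots, Q_n$ are given by \<open>Q :: nat \<Rightarrow> ('q, 'a) pre_digraph\<close>, of which only
  the values at \<open>{1..n}\<close> matter.  In an n-representation \<open>V\<close>, the map
  $\psi_{m,\gamma}^{\gamma'}$ is \<open>psi V m \<gamma> \<gamma>'\<close>.
\<close>

record ('k, 'v, 'q, 'a) nrep =
  rep :: "nat \<Rightarrow> ('k, 'v, 'q, 'a) qrep"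
  psi :: "nat \<Rightarrow> 'a \<Rightarrow> 'a \<Rightarrow> 'v \<Rightarrow> 'v"

definition nreps ::
  "('k, 'r) ring_scheme \<Rightarrow> nat \<Rightarrow> (nat \<Rightarrow> ('q, 'a) pre_digraph) \<Rightarrow>
   ('k, 'v, 'q, 'a) nrep set" where
  "nreps k n Q =
     {V. rep V \<in> (\<Pi>\<^sub>E m \<in> {1..n}. qreps k (Q m)) \<and>
         psi V \<in>
           (\<Pi>\<^sub>E m \<in> {2..n}. \<Pi>\<^sub>E \<gamma> \<in> arcs (Q (m - 1)). \<Pi>\<^sub>E \<gamma>' \<in> arcs (Q m).
              linear_maps k (space (rep V (m - 1)) (head (Q (m - 1)) \<gamma>))
                            (space (rep V m) (tail (Q m) \<gamma>')))}"

definition nrep_hom ::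
  "('k, 'r) ring_scheme \<Rightarrow> nat \<Rightarrow> (nat \<Rightarrow> ('q, 'a) pre_digraph) \<Rightarrow>
   ('k, 'v, 'q, 'a) nrep \<Rightarrow> ('k, 'v, 'q, 'a) nrep \<Rightarrow> (nat \<Rightarrow> 'q \<Rightarrow> 'v \<Rightarrow> 'v) set" where
  "nrep_hom k n Q V W =
     {f \<in> (\<Pi>\<^sub>E m \<in> {1..n}. qrep_hom k (Q m) (rep V m) (rep W m)).
        \<forall>m \<in> {2..n}. \<forall>\<gamma> \<in> arcs (Q (m - 1)). \<forall>\<gamma>' \<in> arcs (Q m).
          compose (carrier (space (rep V (m - 1)) (head (Q (m - 1)) \<gamma>)))
            (f m (tail (Q m) \<gamma>')) (psi V m \<gamma> \<gamma>') =
          compose (carrier (space (rep V (m - 1)) (head (Q (m - 1)) \<gamma>)))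
            (psi W m \<gamma> \<gamma>') (f (m - 1) (head (Q (m - 1)) \<gamma>))}"

definition nrep_family ::
  "nat \<Rightarrow> (nat \<Rightarrow> ('q, 'a) pre_digraph) \<Rightarrow> ('k, 'v, 'q, 'a) nrep \<Rightarrow>
   (nat \<Rightarrow> 'q \<Rightarrow> 'v \<Rightarrow> 'v) \<Rightarrow> (nat \<Rightarrow> 'q \<Rightarrow> 'v \<Rightarrow> 'v)" where
  "nrep_family n Q V F =
     (\<lambda>m \<in> {1..n}. \<lambda>i \<in> verts (Q m). \<lambda>x \<in> carrier (space (rep V m) i). F m i x)"

definition nrep_Hom ::
  "('k, 'r) ring_scheme \<Rightarrow> nat \<Rightarrow> (nat \<Rightarrow> ('q, 'a) pre_digraph) \<Rightarrow>
   ('k, 'v, 'q, 'a) nrep \<Rightarrow> ('k, 'v, 'q, 'a) nrep \<Rightarrow> ('k, nat \<Rightarrow> 'q \<Rightarrow> 'v \<Rightarrow> 'v) module" where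
  "nrep_Hom k n Q V W =
     \<lparr>carrier = nrep_hom k n Q V W,
      monoid.mult = undefined, one = undefined,
      ring.zero = nrep_family n Q V (\<lambda>m i x. \<zero>\<^bsub>space (rep W m) i\<^esub>),
      add = (\<lambda>f g. nrep_family n Q V (\<lambda>m i x. f m i x \<oplus>\<^bsub>space (rep W m) i\<^esub> g m i x)),
      smult = (\<lambda>a f. nrep_family n Q V (\<lambda>m i x. a \<odot>\<^bsub>space (rep W m) i\<^esub> f m i x))\<rparr>"

definition nRep ::
  "('k, 'r) ring_scheme \<Rightarrow> nat \<Rightarrow> (nat \<Rightarrow> ('q, 'a) pre_digraph) \<Rightarrow>
   ('k, ('k, 'v, 'q, 'a) nrep, nat \<Rightarrow> 'q \<Rightarrow> 'v \<Rightarrow> 'v) category_data" where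
  "nRep k n Q =
     \<lparr>Obj = nreps k n Q,
      Hom = nrep_Hom k n Q,
      Cmp = (\<lambda>U V W g f. nrep_family n Q U (\<lambda>m i x. g m i (f m i x))),
      Idn = (\<lambda>V. nrep_family n Q V (\<lambda>m i x. x))\<rparr>"

end

theory Submission
  imports Defs
begin

text \<open>
  Everything is computed vertex by vertex.  An n-representation is the same thing as a
  representation of one big quiver: take the disjoint union of $Q_1, \ldots, Q_n$ and add, for
  every pair of arrows $(\gamma, \gamma')$ of $Q_{m-1}$ and $Q_m$, an arrow from $t(\gamma)$ to
  $s(\gamma')$ that carries $\psi_{m,\gamma}^{\gamma'}$.  Since no relations are imposed, every
  family of vector spaces and linear maps along the arrows is an n-representation
  (\<open>nreps_build\<close>), and a morphism is a family of linear maps that commutes with the maps of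
  all arrows (\<open>nrep_hom_iff\<close>).

  The $k$-linear structure on hom sets is therefore the pointwise one.  A zero object is a family
  of zero spaces, and a direct sum is obtained from direct sums at the vertices, the map
  along an arrow being $i_1 A p_1 + i_2 B p_2$.  A morphism that is pointwise injective with
  pointwise image the kernel of $f$ is a kernel of $f$ (\<open>is_kernelI\<close>), and dually
  (\<open>is_cokernelI\<close>).  The pointwise kernel and image of a morphism are stable under the arrow maps,
  so that subrepresentations and quotients by them exist, and the image $I$ of $f$ gives the
  canonical decomposition: $j : I \to B$ is a kernel of the cokernel of $f$ because the latter
  vanishes exactly on $I$, and $\iota : A \to I$ is onto with the same kernel as $f$.

  Vector spaces have their carriers inside one fixed type \<open>'v\<close>, so it must be checked that direct
  sums and quotients fit into that type.  A quotient is realised on a set of representatives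
  (\<open>quotient_module_exists\<close>).  For the direct sum of $M$ and $N$ an injection of $M \times N$ into
  \<open>'v\<close> is needed (\<open>inj_on_module_pairs\<close>): if \<open>'v\<close> is infinite, it is equipotent to
  \<open>'v \<times> 'v\<close>; if \<open>'v\<close> is finite, all spaces are zero because $k$ is infinite.
  That an algebraically closed field is infinite is the only use of algebraic closedness.
\<close>

section \<open>Linear maps between vector spaces in a fixed type\<close>

lemma linear_mapsI:
  assumes "f \<in> extensional (carrier M)"
    and "\<And>x. x \<in> carrier M \<Longrightarrow> f x \<in> carrier N"
    and "\<And>x y. x \<in> carrier M \<Longrightarrow> y \<in> carrier M \<Longrightarrow> f (x \<oplus>\<^bsub>M\<^esub> y) = f x \<oplus>\<^bsub>N\<^esub> f y"
    and "\<And>a x. a \<in> carrier k \<Longrightarrow> x \<in> carrier M \<Longrightarrow> f (a \<odot>\<^bsub>M\<^esub> x) = a \<odot>\<^bsub>N\<^esub> f x"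
  shows "f \<in> linear_maps k M N"
  using assms by (auto simp: linear_maps_def PiE_def)

lemma linear_mapsD:
  assumes "f \<in> linear_maps k M N"
  shows linear_maps_extensional: "f \<in> extensional (carrier M)"
    and linear_maps_closed: "\<And>x. x \<in> carrier M \<Longrightarrow> f x \<in> carrier N"
    and linear_maps_add: "\<And>x y. x \<in> carrier M \<Longrightarrow> y \<in> carrier M \<Longrightarrow> f (x \<oplus>\<^bsub>M\<^esub> y) = f x \<oplus>\<^bsub>N\<^esub> f y"
    and linear_maps_smult: "\<And>a x. a \<in> carrier k \<Longrightarrow> x \<in> carrier M \<Longrightarrow> f (a \<odot>\<^bsub>M\<^esub> x) = a \<odot>\<^bsub>N\<^esub> f x"
  using assms by (auto simp: linear_maps_def PiE_def)

lemma linear_maps_cong: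
  assumes "\<And>x. x \<in> carrier M \<Longrightarrow> f x = g x" "f \<in> extensional (carrier M)" "g \<in> linear_maps k M N"
  shows "f \<in> linear_maps k M N"
  using assms linear_maps_extensional[OF assms(3)] extensionalityI[of f "carrier M" g] by blast

context module begin

lemma add_commute4:
  assumes "x \<in> carrier M" "y \<in> carrier M" "z \<in> carrier M" "w \<in> carrier M"
  shows "(x \<oplus>\<^bsub>M\<^esub> y) \<oplus>\<^bsub>M\<^esub> (z \<oplus>\<^bsub>M\<^esub> w) = (x \<oplus>\<^bsub>M\<^esub> z) \<oplus>\<^bsub>M\<^esub> (y \<oplus>\<^bsub>M\<^esub> w)"
  using assms by (simp add: M.a_ac)

lemma diff_eq_zero_iff:
  assumes "x \<in> carrier M" "y \<in> carrier M"
  shows "x \<ominus>\<^bsub>M\<^esub> y = \<zero>\<^bsub>M\<^esub> \<longleftrightarrow> x = y"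
  using assms M.minus_equality[of x "\<ominus>\<^bsub>M\<^esub> y"] by (auto simp: a_minus_def M.r_neg)

lemma diff_add_diff:
  assumes "x \<in> carrier M" "y \<in> carrier M" "z \<in> carrier M"
  shows "(x \<ominus>\<^bsub>M\<^esub> y) \<oplus>\<^bsub>M\<^esub> (y \<ominus>\<^bsub>M\<^esub> z) = x \<ominus>\<^bsub>M\<^esub> z"
  using assms by (simp add: a_minus_def M.a_assoc M.r_neg1)

lemma neg_diff:
  assumes "x \<in> carrier M" "y \<in> carrier M"
  shows "\<ominus>\<^bsub>M\<^esub> (x \<ominus>\<^bsub>M\<^esub> y) = y \<ominus>\<^bsub>M\<^esub> x"
  using assms by (simp add: a_minus_def M.minus_add M.a_comm)

lemma neg_eq_smult:
  assumes "x \<in> carrier M"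
  shows "\<ominus>\<^bsub>M\<^esub> x = (\<ominus>\<^bsub>R\<^esub> \<one>\<^bsub>R\<^esub>) \<odot>\<^bsub>M\<^esub> x"
  using assms by (simp add: smult_l_minus)

end

lemma linear_maps_zero:
  assumes "module k M" "module k N" "f \<in> linear_maps k M N"
  shows "f \<zero>\<^bsub>M\<^esub> = \<zero>\<^bsub>N\<^esub>"
proof -
  interpret M: module k M by fact
  interpret N: module k N by fact
  have "f (\<zero>\<^bsub>k\<^esub> \<odot>\<^bsub>M\<^esub> \<zero>\<^bsub>M\<^esub>) = \<zero>\<^bsub>k\<^esub> \<odot>\<^bsub>N\<^esub> f \<zero>\<^bsub>M\<^esub>"
    by (rule linear_maps_smult[OF assms(3)]) auto
  then show ?thesis
    using linear_maps_closed[OF assms(3), of "\<zero>\<^bsub>M\<^esub>"] by simp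
qed

lemma linear_maps_diff:
  assumes "module k M" "module k N" "f \<in> linear_maps k M N" "x \<in> carrier M" "y \<in> carrier M"
  shows "f (x \<ominus>\<^bsub>M\<^esub> y) = f x \<ominus>\<^bsub>N\<^esub> f y"
proof -
  interpret M: module k M by fact
  interpret N: module k N by fact
  show ?thesis
    using assms linear_maps_closed[OF assms(3)] linear_maps_add[OF assms(3)]
      linear_maps_smult[OF assms(3)]
    by (simp add: a_minus_def M.neg_eq_smult N.neg_eq_smult)
qed

lemma linear_maps_eq_iff:
  assumes "module k M" "module k N" "f \<in> linear_maps k M N" "x \<in> carrier M" "y \<in> carrier M"
  shows "f x = f y \<longleftrightarrow> f (x \<ominus>\<^bsub>M\<^esub> y) = \<zero>\<^bsub>N\<^esub>"
proof -
  interpret M: module k M by fact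
  interpret N: module k N by fact
  show ?thesis
    using assms linear_maps_closed[OF assms(3)] N.diff_eq_zero_iff
    by (simp add: linear_maps_diff[OF assms])
qed

lemma linear_maps_compose:
  assumes "module k M" "f \<in> linear_maps k M N" "g \<in> linear_maps k N L"
  shows "(\<lambda>x \<in> carrier M. g (f x)) \<in> linear_maps k M L"
proof -
  interpret M: module k M by fact
  show ?thesis
    using linear_mapsD[OF assms(2)] linear_mapsD[OF assms(3)]
    by (intro linear_mapsI) auto
qed

lemma linear_maps_sum:
  assumes "module k M" "module k N" "f \<in> linear_maps k M N" "g \<in> linear_maps k M N"
  shows "(\<lambda>x \<in> carrier M. f x \<oplus>\<^bsub>N\<^esub> g x) \<in> linear_maps k M N"
proof -
  interpret M: module k M by fact
  interpret N: module k N by fact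
  show ?thesis
    using linear_mapsD[OF assms(3)] linear_mapsD[OF assms(4)]
    by (intro linear_mapsI) (auto simp: N.add_commute4 N.smult_r_distr)
qed

lemma linear_maps_scale:
  assumes "module k M" "module k N" "f \<in> linear_maps k M N" "a \<in> carrier k"
  shows "(\<lambda>x \<in> carrier M. a \<odot>\<^bsub>N\<^esub> f x) \<in> linear_maps k M N"
proof -
  interpret M: module k M by fact
  interpret N: module k N by fact
  show ?thesis
    using linear_mapsD[OF assms(3)] assms(4)
    by (intro linear_mapsI) (auto simp: N.smult_r_distr N.smult_assoc1[symmetric] M.m_comm)
qed

lemma linear_maps_zero_map:
  assumes "module k M" "module k N"
  shows "(\<lambda>x \<in> carrier M. \<zero>\<^bsub>N\<^esub>) \<in> linear_maps k M N"
proof -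
  interpret M: module k M by fact
  interpret N: module k N by fact
  show ?thesis
    by (intro linear_mapsI) auto
qed

lemma linear_maps_ident:
  assumes "module k M"
  shows "(\<lambda>x \<in> carrier M. x) \<in> linear_maps k M M"
proof -
  interpret M: module k M by fact
  show ?thesis
    by (intro linear_mapsI) auto
qed

lemma submodule_kernel:
  assumes "module k M" "module k N" "f \<in> linear_maps k M N"
  shows "submodule {x \<in> carrier M. f x = \<zero>\<^bsub>N\<^esub>} k M"
proof -
  interpret M: module k M by fact
  interpret N: module k N by fact
  show ?thesis
    using linear_mapsD[OF assms(3)] linear_maps_zero[OF assms]
    by (intro M.submoduleI) (auto simp: M.neg_eq_smult)
qed

lemma submodule_image:
  assumes "module k M" "module k N" "f \<in> linear_maps k M N"
  shows "submodule (f ` carrier M) k N"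
proof -
  interpret M: module k M by fact
  interpret N: module k N by fact
  note f = linear_mapsD[OF assms(3)]
  show ?thesis
  proof (rule N.submoduleI)
    show "\<zero>\<^bsub>N\<^esub> \<in> f ` carrier M"
      using linear_maps_zero[OF assms] by (metis M.zero_closed image_eqI)
    show smult: "a \<odot>\<^bsub>N\<^esub> y \<in> f ` carrier M" if "a \<in> carrier k" "y \<in> f ` carrier M" for a y
      using that f(4) M.smult_closed by (metis (no_types, lifting) image_iff)
    show "\<ominus>\<^bsub>N\<^esub> y \<in> f ` carrier M" if "y \<in> f ` carrier M" for y
      using smult[of "\<ominus>\<^bsub>k\<^esub> \<one>\<^bsub>k\<^esub>" y] that f(2) by (auto simp: N.neg_eq_smult)
    show "y \<oplus>\<^bsub>N\<^esub> z \<in> f ` carrier M" if "y \<in> f ` carrier M" "z \<in> f ` carrier M" for y z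
      using that f(3) M.a_closed by (metis (no_types, lifting) image_iff)
  qed (use f in auto)
qed

text \<open>
  Universal property of a quotient map and of an embedding.  The first one yields both the arrow
  maps of a quotient representation and the factorisations through a cokernel.
\<close>

lemma linear_maps_factor_surj:
  assumes M: "module k M" "module k D" "module k T"
    and q: "q \<in> linear_maps k M D" "q ` carrier M = carrier D"
    and g: "g \<in> linear_maps k M T"
    and ker: "\<And>x. x \<in> carrier M \<Longrightarrow> q x = \<zero>\<^bsub>D\<^esub> \<Longrightarrow> g x = \<zero>\<^bsub>T\<^esub>"
  shows "\<exists>u \<in> linear_maps k D T. \<forall>x \<in> carrier M. u (q x) = g x"
proof -
  interpret M: module k M by fact
  interpret D: module k D by fact
  interpret T: module k T by fact
  define s where "s = inv_into (carrier M) q"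
  define u where "u = (\<lambda>y \<in> carrier D. g (s y))"
  have s: "s y \<in> carrier M" "q (s y) = y" if "y \<in> carrier D" for y
    using that q(2) by (metis inv_into_into s_def, metis f_inv_into_f s_def)
  have u: "u (q x) = g x" if "x \<in> carrier M" for x
  proof -
    have qx: "q x \<in> carrier D" using that q(2) by blast
    have "g (s (q x)) = g x"
      using ker[of "s (q x) \<ominus>\<^bsub>M\<^esub> x"] s[OF qx] that
      by (simp add: linear_maps_eq_iff[OF M(1,3) g] linear_maps_diff[OF M(1,2) q(1)] qx)
        (metis D.diff_eq_zero_iff qx)
    then show ?thesis by (simp add: u_def qx)
  qed
  have "u \<in> linear_maps k D T"
  proof (rule linear_mapsI)
    show "u \<in> extensional (carrier D)" by (simp add: u_def)
    show "u y \<in> carrier T" if "y \<in> carrier D" for y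
      using that s linear_maps_closed[OF g] by (simp add: u_def)
    show "u (y \<oplus>\<^bsub>D\<^esub> z) = u y \<oplus>\<^bsub>T\<^esub> u z" if "y \<in> carrier D" "z \<in> carrier D" for y z
    proof -
      have "u (q (s y \<oplus>\<^bsub>M\<^esub> s z)) = u (q (s y)) \<oplus>\<^bsub>T\<^esub> u (q (s z))"
        using s that by (subst (1 2 3) u) (simp_all add: linear_maps_add[OF g])
      then show ?thesis
        using s that by (simp add: linear_maps_add[OF q(1)])
    qed
    show "u (a \<odot>\<^bsub>D\<^esub> y) = a \<odot>\<^bsub>T\<^esub> u y" if "a \<in> carrier k" "y \<in> carrier D" for a y
    proof -
      have "u (q (a \<odot>\<^bsub>M\<^esub> s y)) = a \<odot>\<^bsub>T\<^esub> u (q (s y))"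
        using s that by (subst (1 2) u) (simp_all add: linear_maps_smult[OF g])
      then show ?thesis
        using s that by (simp add: linear_maps_smult[OF q(1)])
    qed
  qed
  with u show ?thesis by blast
qed

lemma linear_maps_factor_inj:
  assumes M: "module k T" "module k K"
    and i: "i \<in> linear_maps k K M" "inj_on i (carrier K)"
    and g: "g \<in> linear_maps k T M" "g ` carrier T \<subseteq> i ` carrier K"
  shows "\<exists>u \<in> linear_maps k T K. \<forall>x \<in> carrier T. i (u x) = g x"
proof -
  interpret T: module k T by fact
  interpret K: module k K by fact
  define u where "u = (\<lambda>x \<in> carrier T. inv_into (carrier K) i (g x))"
  have u: "u x \<in> carrier K" "i (u x) = g x" if "x \<in> carrier T" for x
    using that g(2) by (auto simp: u_def inv_into_into f_inv_into_f image_subset_iff)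
  have "u \<in> linear_maps k T K"
  proof (rule linear_mapsI)
    show "u \<in> extensional (carrier T)" by (simp add: u_def)
    show "u x \<in> carrier K" if "x \<in> carrier T" for x using u that by simp
    show "u (x \<oplus>\<^bsub>T\<^esub> y) = u x \<oplus>\<^bsub>K\<^esub> u y" if "x \<in> carrier T" "y \<in> carrier T" for x y
      by (rule inj_onD[OF i(2)])
        (use u that in \<open>auto simp: linear_maps_add[OF i(1)] linear_maps_add[OF g(1)]\<close>)
    show "u (a \<odot>\<^bsub>T\<^esub> x) = a \<odot>\<^bsub>K\<^esub> u x" if "a \<in> carrier k" "x \<in> carrier T" for a x
      by (rule inj_onD[OF i(2)])
        (use u that in \<open>auto simp: linear_maps_smult[OF i(1)] linear_maps_smult[OF g(1)]\<close>)
  qed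
  with u show ?thesis by blast
qed

section \<open>Quotients and direct sums inside a fixed type\<close>

text \<open>
  Transport of structure: the image of a module under a map whose fibres form a congruence is a
  module.  For an injective map this moves a module to another type, for a choice of
  representatives it forms a quotient.
\<close>

lemma module_image_of_congruence:
  fixes M :: "('k, 'a) module" and h :: "'a \<Rightarrow> 'b"
  assumes "module k M"
    and add: "\<And>x x' y y'. \<lbrakk>x \<in> carrier M; x' \<in> carrier M; y \<in> carrier M; y' \<in> carrier M;
        h x = h x'; h y = h y'\<rbrakk> \<Longrightarrow> h (x \<oplus>\<^bsub>M\<^esub> y) = h (x' \<oplus>\<^bsub>M\<^esub> y')"
    and smult: "\<And>a x x'. \<lbrakk>a \<in> carrier k; x \<in> carrier M; x' \<in> carrier M; h x = h x'\<rbrakk>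
        \<Longrightarrow> h (a \<odot>\<^bsub>M\<^esub> x) = h (a \<odot>\<^bsub>M\<^esub> x')"
  shows "\<exists>N :: ('k, 'b) module. module k N \<and> carrier N = h ` carrier M \<and> h \<zero>\<^bsub>M\<^esub> = \<zero>\<^bsub>N\<^esub> \<and>
     (\<forall>x \<in> carrier M. \<forall>y \<in> carrier M. h (x \<oplus>\<^bsub>M\<^esub> y) = h x \<oplus>\<^bsub>N\<^esub> h y) \<and>
     (\<forall>a \<in> carrier k. \<forall>x \<in> carrier M. h (a \<odot>\<^bsub>M\<^esub> x) = a \<odot>\<^bsub>N\<^esub> h x)"
proof -
  interpret M: module k M by fact
  define s where "s = inv_into (carrier M) h"
  define N :: "('k, 'b) module" where
    "N = \<lparr>carrier = h ` carrier M, monoid.mult = undefined, one = undefined,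
          ring.zero = h \<zero>\<^bsub>M\<^esub>, add = (\<lambda>u v. h (s u \<oplus>\<^bsub>M\<^esub> s v)), smult = (\<lambda>a u. h (a \<odot>\<^bsub>M\<^esub> s u))\<rparr>"
  have s: "s (h x) \<in> carrier M" "h (s (h x)) = h x" if "x \<in> carrier M" for x
    using that by (auto simp: s_def inv_into_into f_inv_into_f)
  have carrier: "carrier N = h ` carrier M" and zero: "\<zero>\<^bsub>N\<^esub> = h \<zero>\<^bsub>M\<^esub>"
    by (simp_all add: N_def)
  have N_add: "h x \<oplus>\<^bsub>N\<^esub> h y = h (x \<oplus>\<^bsub>M\<^esub> y)" if "x \<in> carrier M" "y \<in> carrier M" for x y
    unfolding N_def using that s by (auto intro!: add)
  have N_smult: "a \<odot>\<^bsub>N\<^esub> h x = h (a \<odot>\<^bsub>M\<^esub> x)" if "a \<in> carrier k" "x \<in> carrier M" for a x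
    unfolding N_def using that s by (auto intro!: smult)
  have "abelian_group N"
  proof (rule abelian_groupI)
    show "\<exists>y \<in> carrier N. y \<oplus>\<^bsub>N\<^esub> x = \<zero>\<^bsub>N\<^esub>" if x: "x \<in> carrier N" for x
    proof -
      obtain z where "z \<in> carrier M" "x = h z" using x carrier by blast
      then show ?thesis
        by (intro bexI[of _ "h (\<ominus>\<^bsub>M\<^esub> z)"]) (auto simp: N_add zero carrier M.l_neg)
    qed
  qed (auto simp: carrier zero N_add M.a_ac)
  then have "module k N"
    by (intro moduleI)
      (auto simp: carrier N_add N_smult M.smult_l_distr M.smult_r_distr M.smult_assoc1
        M.is_cring)
  then show ?thesis
    using carrier zero N_add N_smult by (intro exI[of _ N]) auto
qed

text \<open>
  The quotient by \<open>U\<close> is carried by one chosen representative of each coset, so that it lives in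
  the same type as \<open>M\<close>.
\<close>

lemma quotient_module_exists:
  fixes M :: "('k, 'v) module"
  assumes M: "module k M" and U: "submodule U k M"
  shows "\<exists>(D :: ('k, 'v) module) q. module k D \<and> q \<in> linear_maps k M D \<and>
     q ` carrier M = carrier D \<and> (\<forall>x \<in> carrier M. q x = \<zero>\<^bsub>D\<^esub> \<longleftrightarrow> x \<in> U)"
proof -
  interpret M: module k M by fact
  note U = M.submoduleE[OF U]
  define r where "r x y \<longleftrightarrow> y \<in> carrier M \<and> x \<ominus>\<^bsub>M\<^esub> y \<in> U" for x y
  \<comment> \<open>\<open>h x\<close> depends on the coset of \<open>x\<close> only, as the predicates \<open>r x\<close> and \<open>r y\<close> agree on a coset.\<close>
  define h where "h x = (SOME y. r x y)" for x
  have Uzero: "\<zero>\<^bsub>M\<^esub> \<in> U"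
    using U(1,2,3,5) by (metis M.r_neg all_not_in_conv subsetD)
  have r_refl: "r x x" if "x \<in> carrier M" for x
    using that Uzero by (simp add: r_def a_minus_def M.r_neg)
  have h_eq: "h x = h y \<longleftrightarrow> x \<ominus>\<^bsub>M\<^esub> y \<in> U" if xy: "x \<in> carrier M" "y \<in> carrier M" for x y
  proof
    assume d: "x \<ominus>\<^bsub>M\<^esub> y \<in> U"
    have "r x z \<longleftrightarrow> r y z" for z
    proof -
      have "x \<ominus>\<^bsub>M\<^esub> z = (x \<ominus>\<^bsub>M\<^esub> y) \<oplus>\<^bsub>M\<^esub> (y \<ominus>\<^bsub>M\<^esub> z)" "y \<ominus>\<^bsub>M\<^esub> z = \<ominus>\<^bsub>M\<^esub> (x \<ominus>\<^bsub>M\<^esub> y) \<oplus>\<^bsub>M\<^esub> (x \<ominus>\<^bsub>M\<^esub> z)"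
        if "z \<in> carrier M"
        using xy that by (simp_all add: M.neg_diff M.diff_add_diff)
      then show ?thesis
        using d U(3,5) unfolding r_def by metis
    qed
    then show "h x = h y" by (simp add: h_def)
  next
    assume e: "h x = h y"
    have "r x (h x)" "r y (h y)"
      unfolding h_def using r_refl xy by (metis someI)+
    then have "h x \<in> carrier M" "x \<ominus>\<^bsub>M\<^esub> h x \<in> U" "\<ominus>\<^bsub>M\<^esub> (y \<ominus>\<^bsub>M\<^esub> h x) \<in> U"
      using e U(3) by (auto simp: r_def)
    moreover have "x \<ominus>\<^bsub>M\<^esub> y = (x \<ominus>\<^bsub>M\<^esub> h x) \<oplus>\<^bsub>M\<^esub> \<ominus>\<^bsub>M\<^esub> (y \<ominus>\<^bsub>M\<^esub> h x)"
      using xy \<open>h x \<in> carrier M\<close> by (simp add: M.neg_diff M.diff_add_diff)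
    ultimately show "x \<ominus>\<^bsub>M\<^esub> y \<in> U" using U(5) by metis
  qed
  have "\<exists>N :: ('k, 'v) module. module k N \<and> carrier N = h ` carrier M \<and> h \<zero>\<^bsub>M\<^esub> = \<zero>\<^bsub>N\<^esub> \<and>
     (\<forall>x \<in> carrier M. \<forall>y \<in> carrier M. h (x \<oplus>\<^bsub>M\<^esub> y) = h x \<oplus>\<^bsub>N\<^esub> h y) \<and>
     (\<forall>a \<in> carrier k. \<forall>x \<in> carrier M. h (a \<odot>\<^bsub>M\<^esub> x) = a \<odot>\<^bsub>N\<^esub> h x)"
  proof (rule module_image_of_congruence[OF M])
    fix x x' y y' assume c: "x \<in> carrier M" "x' \<in> carrier M" "y \<in> carrier M" "y' \<in> carrier M"
      and "h x = h x'" "h y = h y'"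
    then have "(x \<ominus>\<^bsub>M\<^esub> x') \<oplus>\<^bsub>M\<^esub> (y \<ominus>\<^bsub>M\<^esub> y') \<in> U" using U(5) by (simp add: h_eq)
    moreover have "(x \<ominus>\<^bsub>M\<^esub> x') \<oplus>\<^bsub>M\<^esub> (y \<ominus>\<^bsub>M\<^esub> y') = (x \<oplus>\<^bsub>M\<^esub> y) \<ominus>\<^bsub>M\<^esub> (x' \<oplus>\<^bsub>M\<^esub> y')"
      using c by (simp add: a_minus_def M.a_ac M.minus_add)
    ultimately show "h (x \<oplus>\<^bsub>M\<^esub> y) = h (x' \<oplus>\<^bsub>M\<^esub> y')"
      using c by (simp add: h_eq)
  next
    fix a x x' assume c: "a \<in> carrier k" "x \<in> carrier M" "x' \<in> carrier M" and "h x = h x'"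
    then have "a \<odot>\<^bsub>M\<^esub> (x \<ominus>\<^bsub>M\<^esub> x') \<in> U" using U(4) by (simp add: h_eq)
    then show "h (a \<odot>\<^bsub>M\<^esub> x) = h (a \<odot>\<^bsub>M\<^esub> x')"
      using c by (simp add: h_eq a_minus_def M.smult_r_distr M.smult_r_minus)
  qed
  then obtain N :: "('k, 'v) module" where N: "module k N" "carrier N = h ` carrier M"
    "h \<zero>\<^bsub>M\<^esub> = \<zero>\<^bsub>N\<^esub>"
    "\<And>x y. x \<in> carrier M \<Longrightarrow> y \<in> carrier M \<Longrightarrow> h (x \<oplus>\<^bsub>M\<^esub> y) = h x \<oplus>\<^bsub>N\<^esub> h y"
    "\<And>a x. a \<in> carrier k \<Longrightarrow> x \<in> carrier M \<Longrightarrow> h (a \<odot>\<^bsub>M\<^esub> x) = a \<odot>\<^bsub>N\<^esub> h x"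
    by metis
  have "h x = \<zero>\<^bsub>N\<^esub> \<longleftrightarrow> x \<in> U" if "x \<in> carrier M" for x
    using h_eq[OF that M.zero_closed] that by (simp add: N(3) a_minus_def M.neg_eq_smult)
  moreover have "restrict h (carrier M) \<in> linear_maps k M N"
    by (rule linear_mapsI) (auto simp: N)
  ultimately show ?thesis
    using N(1,2) by (intro exI[of _ N] exI[of _ "restrict h (carrier M)"]) auto
qed

text \<open>
  The map $x \mapsto x^2 - x$ is onto, since $X^2 - X - a$ has a root for every $a$, but it takes
  the value $0$ at both $0$ and $1$; on a finite set this is impossible.
\<close>

lemma (in algebraically_closed) infinite_carrier: "infinite (carrier L)"
proof
  assume fin: "finite (carrier L)"
  define g where "g x = x \<otimes> x \<ominus> x" for x
  have closed: "g x \<in> carrier L" if "x \<in> carrier L" for x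
    using that by (simp add: g_def)
  have "carrier L \<subseteq> g ` carrier L"
  proof
    fix a assume a: "a \<in> carrier L"
    define p where "p = [\<one>, \<ominus> \<one>, \<ominus> a]"
    have p: "p \<in> carrier (poly_ring L)"
      using a by (simp add: p_def univ_poly_def polynomial_def)
    have "size (roots p) = 2"
      using roots_over_carrier[OF p] by (simp add: splitted_def p_def)
    then obtain r where "r \<in># roots p"
      by (metis multiset_nonemptyE size_empty zero_neq_numeral)
    then have "is_root p r"
      using roots_mem_iff_is_root[OF p] by simp
    then have r: "r \<in> carrier L" and "eval p r = \<zero>"
      by (auto simp: is_root_def)
    then have "(r \<otimes> r \<oplus> \<ominus> r) \<oplus> \<ominus> a = \<zero>"
      using a by (simp add: p_def numeral_2_eq_2 l_minus a_assoc)
    then have "g r = a"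
      using r a by (metis a_minus_def closed g_def r_right_minus_eq)
    then show "a \<in> g ` carrier L" using r by blast
  qed
  then have "inj_on g (carrier L)"
    using fin closed by (intro eq_card_imp_inj_on) (auto intro!: arg_cong[of _ _ card])
  moreover have "g \<zero> = g \<one>"
    by (simp add: g_def a_minus_def r_neg)
  ultimately show False
    using inj_onD zero_closed one_closed zero_not_one by metis
qed


text \<open>
  A direct sum of two vector spaces, described by its injections and projections, so that its
  carrier may be any subset of \<open>'v\<close>.
\<close>

definition is_biproduct ::
  "('k, 'r) ring_scheme \<Rightarrow> ('k, 'v) module \<Rightarrow> ('k, 'v) module \<Rightarrow> ('k, 'v) module \<Rightarrow>
   ('v \<Rightarrow> 'v) \<Rightarrow> ('v \<Rightarrow> 'v) \<Rightarrow> ('v \<Rightarrow> 'v) \<Rightarrow> ('v \<Rightarrow> 'v) \<Rightarrow> bool" where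
  "is_biproduct k M N S i\<^sub>1 i\<^sub>2 p\<^sub>1 p\<^sub>2 \<longleftrightarrow> module k S \<and>
     i\<^sub>1 \<in> linear_maps k M S \<and> i\<^sub>2 \<in> linear_maps k N S \<and>
     p\<^sub>1 \<in> linear_maps k S M \<and> p\<^sub>2 \<in> linear_maps k S N \<and>
     (\<forall>x \<in> carrier M. p\<^sub>1 (i\<^sub>1 x) = x \<and> p\<^sub>2 (i\<^sub>1 x) = \<zero>\<^bsub>N\<^esub>) \<and>
     (\<forall>y \<in> carrier N. p\<^sub>1 (i\<^sub>2 y) = \<zero>\<^bsub>M\<^esub> \<and> p\<^sub>2 (i\<^sub>2 y) = y) \<and>
     (\<forall>s \<in> carrier S. i\<^sub>1 (p\<^sub>1 s) \<oplus>\<^bsub>S\<^esub> i\<^sub>2 (p\<^sub>2 s) = s)"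

text \<open>
  The direct sum on the product type.  The two fields for a ring multiplication are left
  unspecified, being irrelevant for modules.
\<close>

definition product_module ::
  "('k, 'v) module \<Rightarrow> ('k, 'w) module \<Rightarrow> ('k, 'v \<times> 'w) module" where
  "product_module M N = \<lparr>carrier = carrier M \<times> carrier N, monoid.mult = undefined, one = undefined,
      ring.zero = (\<zero>\<^bsub>M\<^esub>, \<zero>\<^bsub>N\<^esub>),
      add = (\<lambda>u v. (fst u \<oplus>\<^bsub>M\<^esub> fst v, snd u \<oplus>\<^bsub>N\<^esub> snd v)),
      smult = (\<lambda>a u. (a \<odot>\<^bsub>M\<^esub> fst u, a \<odot>\<^bsub>N\<^esub> snd u))\<rparr>"

lemma module_product_module:
  assumes "module k M" "module k N"
  shows "module k (product_module M N)" (is "module k ?P")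
proof -
  interpret M: module k M by fact
  interpret N: module k N by fact
  have "abelian_group ?P"
  proof (rule abelian_groupI)
    show "\<exists>v \<in> carrier ?P. v \<oplus>\<^bsub>?P\<^esub> u = \<zero>\<^bsub>?P\<^esub>" if "u \<in> carrier ?P" for u
      using that
      by (intro bexI[of _ "(\<ominus>\<^bsub>M\<^esub> fst u, \<ominus>\<^bsub>N\<^esub> snd u)"]) (auto simp: product_module_def M.l_neg N.l_neg)
  qed (auto simp: product_module_def M.a_ac N.a_ac)
  then show ?thesis
    by (intro moduleI)
      (auto simp: product_module_def M.smult_l_distr M.smult_r_distr M.smult_assoc1
        N.smult_l_distr N.smult_r_distr N.smult_assoc1 M.is_cring)
qed

lemma infinite_module_carrier:
  assumes "field k" "infinite (carrier k)" "module k M" "x \<in> carrier M" "x \<noteq> \<zero>\<^bsub>M\<^esub>"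
  shows "infinite (carrier M)"
proof -
  interpret k: field k by fact
  interpret M: module k M by fact
  have "inj_on (\<lambda>a. a \<odot>\<^bsub>M\<^esub> x) (carrier k)"
  proof (rule inj_onI, rule ccontr)
    fix a b assume ab: "a \<in> carrier k" "b \<in> carrier k" and eq: "a \<odot>\<^bsub>M\<^esub> x = b \<odot>\<^bsub>M\<^esub> x" and "a \<noteq> b"
    define c where "c = a \<ominus>\<^bsub>k\<^esub> b"
    have c: "c \<in> carrier k" "c \<noteq> \<zero>\<^bsub>k\<^esub>"
      using ab \<open>a \<noteq> b\<close> by (simp_all add: c_def)
    have "c \<odot>\<^bsub>M\<^esub> x = \<zero>\<^bsub>M\<^esub>"
      using ab eq assms(4)
      by (simp add: c_def a_minus_def[of k] M.smult_l_distr M.smult_l_minus M.r_neg)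
    moreover have "c \<in> Units k"
      using c k.field_Units by blast
    ultimately have "(inv\<^bsub>k\<^esub> c \<otimes>\<^bsub>k\<^esub> c) \<odot>\<^bsub>M\<^esub> x = \<zero>\<^bsub>M\<^esub>"
      using c assms(4) by (simp add: M.smult_assoc1 del: k.Units_l_inv)
    then show False
      using \<open>c \<in> Units k\<close> assms(4,5) by simp
  qed
  then have "infinite ((\<lambda>a. a \<odot>\<^bsub>M\<^esub> x) ` carrier k)"
    using assms(2) finite_imageD by blast
  moreover have "(\<lambda>a. a \<odot>\<^bsub>M\<^esub> x) ` carrier k \<subseteq> carrier M"
    using assms(4) by auto
  ultimately show ?thesis
    using finite_subset by blast
qed

text \<open>
  In a finite type the injection exists for a trivial reason: vector spaces over an infinite
  field are then zero.
\<close>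

lemma inj_on_module_pairs:
  fixes M N :: "('k, 'v) module"
  assumes "field k" "infinite (carrier k)" "module k M" "module k N"
  shows "\<exists>h :: 'v \<times> 'v \<Rightarrow> 'v. inj_on h (carrier M \<times> carrier N)"
proof (cases "finite (UNIV :: 'v set)")
  case True
  then have "finite A" for A :: "'v set"
    using finite_subset subset_UNIV by blast
  then have "carrier M \<subseteq> {\<zero>\<^bsub>M\<^esub>}" "carrier N \<subseteq> {\<zero>\<^bsub>N\<^esub>}"
    using infinite_module_carrier[OF assms(1,2,3)] infinite_module_carrier[OF assms(1,2,4)]
    by auto
  then have "inj_on (\<lambda>_. undefined) (carrier M \<times> carrier N)"
    by (auto simp: inj_on_def)
  then show ?thesis by blast
next
  case False
  then obtain h :: "'v \<times> 'v \<Rightarrow> 'v" where "bij_betw h (UNIV \<times> UNIV) UNIV"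
    using iffD2[OF card_of_ordIso card_of_Times_same_infinite] by blast
  then have "inj_on h (carrier M \<times> carrier N)"
    by (rule inj_on_subset[OF bij_betw_imp_inj_on]) auto
  then show ?thesis by blast
qed

lemma biproduct_exists:
  fixes M N :: "('k, 'v) module"
  assumes "field k" "infinite (carrier k)" and M: "module k M" and N: "module k N"
  shows "\<exists>S i\<^sub>1 i\<^sub>2 p\<^sub>1 p\<^sub>2. is_biproduct k M N S i\<^sub>1 i\<^sub>2 p\<^sub>1 p\<^sub>2"
proof -
  interpret M: module k M by fact
  interpret N: module k N by fact
  obtain h :: "'v \<times> 'v \<Rightarrow> 'v" where inj: "inj_on h (carrier M \<times> carrier N)"
    using inj_on_module_pairs[OF assms] by blast
  let ?P = "product_module M N"
  have "\<exists>S :: ('k, 'v) module. module k S \<and> carrier S = h ` carrier ?P \<and> h \<zero>\<^bsub>?P\<^esub> = \<zero>\<^bsub>S\<^esub> \<and>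
     (\<forall>x \<in> carrier ?P. \<forall>y \<in> carrier ?P. h (x \<oplus>\<^bsub>?P\<^esub> y) = h x \<oplus>\<^bsub>S\<^esub> h y) \<and>
     (\<forall>a \<in> carrier k. \<forall>x \<in> carrier ?P. h (a \<odot>\<^bsub>?P\<^esub> x) = a \<odot>\<^bsub>S\<^esub> h x)"
    by (rule module_image_of_congruence[OF module_product_module[OF M N]])
      (auto simp: product_module_def dest: inj_onD[OF inj])
  then obtain S :: "('k, 'v) module" where S: "module k S" "carrier S = h ` carrier ?P"
    and "\<forall>x \<in> carrier ?P. \<forall>y \<in> carrier ?P. h (x \<oplus>\<^bsub>?P\<^esub> y) = h x \<oplus>\<^bsub>S\<^esub> h y"
    and "\<forall>a \<in> carrier k. \<forall>x \<in> carrier ?P. h (a \<odot>\<^bsub>?P\<^esub> x) = a \<odot>\<^bsub>S\<^esub> h x"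
    by blast
  then have S_add: "\<And>x y x' y'. \<lbrakk>x \<in> carrier M; y \<in> carrier N; x' \<in> carrier M; y' \<in> carrier N\<rbrakk>
      \<Longrightarrow> h (x, y) \<oplus>\<^bsub>S\<^esub> h (x', y') = h (x \<oplus>\<^bsub>M\<^esub> x', y \<oplus>\<^bsub>N\<^esub> y')"
    and S_smult: "\<And>a x y. \<lbrakk>a \<in> carrier k; x \<in> carrier M; y \<in> carrier N\<rbrakk>
      \<Longrightarrow> a \<odot>\<^bsub>S\<^esub> h (x, y) = h (a \<odot>\<^bsub>M\<^esub> x, a \<odot>\<^bsub>N\<^esub> y)"
    by (auto simp: product_module_def)
  have S_carrier: "carrier S = h ` (carrier M \<times> carrier N)"
    by (simp add: S product_module_def)
  define g where "g = inv_into (carrier M \<times> carrier N) h"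
  have g: "g (h (x, y)) = (x, y)" if "x \<in> carrier M" "y \<in> carrier N" for x y
    unfolding g_def using that inj by simp
  define i\<^sub>1 i\<^sub>2 p\<^sub>1 p\<^sub>2 where "i\<^sub>1 = (\<lambda>x \<in> carrier M. h (x, \<zero>\<^bsub>N\<^esub>))"
    and "i\<^sub>2 = (\<lambda>y \<in> carrier N. h (\<zero>\<^bsub>M\<^esub>, y))"
    and "p\<^sub>1 = (\<lambda>s \<in> carrier S. fst (g s))" and "p\<^sub>2 = (\<lambda>s \<in> carrier S. snd (g s))"
  note defs = i\<^sub>1_def i\<^sub>2_def p\<^sub>1_def p\<^sub>2_def
  have in_S: "h (x, y) \<in> carrier S" if "x \<in> carrier M" "y \<in> carrier N" for x y
    using that by (simp add: S_carrier)
  have S_cases: "\<exists>x \<in> carrier M. \<exists>y \<in> carrier N. s = h (x, y)" if "s \<in> carrier S" for s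
    using that by (auto simp: S_carrier)
  have p: "p\<^sub>1 (h (x, y)) = x" "p\<^sub>2 (h (x, y)) = y" if "x \<in> carrier M" "y \<in> carrier N" for x y
    using that by (simp_all add: p\<^sub>1_def p\<^sub>2_def in_S g)
  have "i\<^sub>1 \<in> linear_maps k M S"
    by (rule linear_mapsI) (simp_all add: i\<^sub>1_def in_S S_add S_smult)
  moreover have "i\<^sub>2 \<in> linear_maps k N S"
    by (rule linear_mapsI) (simp_all add: i\<^sub>2_def in_S S_add S_smult)
  moreover have "p\<^sub>1 \<in> linear_maps k S M"
    by (rule linear_mapsI; (unfold p\<^sub>1_def, rule restrict_extensional)?)
      (auto simp: p in_S S_add S_smult dest!: S_cases)
  moreover have "p\<^sub>2 \<in> linear_maps k S N"
    by (rule linear_mapsI; (unfold p\<^sub>2_def, rule restrict_extensional)?)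
      (auto simp: p in_S S_add S_smult dest!: S_cases)
  moreover have "p\<^sub>1 (i\<^sub>1 x) = x \<and> p\<^sub>2 (i\<^sub>1 x) = \<zero>\<^bsub>N\<^esub>" if "x \<in> carrier M" for x
    using that by (simp add: defs g in_S)
  moreover have "p\<^sub>1 (i\<^sub>2 y) = \<zero>\<^bsub>M\<^esub> \<and> p\<^sub>2 (i\<^sub>2 y) = y" if "y \<in> carrier N" for y
    using that by (simp add: defs g in_S)
  moreover have "i\<^sub>1 (p\<^sub>1 s) \<oplus>\<^bsub>S\<^esub> i\<^sub>2 (p\<^sub>2 s) = s" if "s \<in> carrier S" for s
    using S_cases[OF that] by (auto simp: defs g in_S S_add)
  ultimately have "is_biproduct k M N S i\<^sub>1 i\<^sub>2 p\<^sub>1 p\<^sub>2"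
    using S(1) by (simp add: is_biproduct_def)
  then show ?thesis by blast
qed

section \<open>N-representations as representations of one quiver\<close>

text \<open>
  The arrows of the glued quiver: \<open>Inner m \<alpha>\<close> is the arrow \<open>\<alpha>\<close> of $Q_m$, and
  \<open>Link m \<gamma> \<gamma>'\<close> is the additional arrow that carries $\psi_{m,\gamma}^{\gamma'}$.
  Its vertices are the pairs \<open>(m, i)\<close> with \<open>i\<close> a vertex of $Q_m$.
\<close>

datatype 'a edge = Inner nat 'a | Link nat 'a 'a

definition glued_verts :: "nat \<Rightarrow> (nat \<Rightarrow> ('q, 'a) pre_digraph) \<Rightarrow> (nat \<times> 'q) set" where
  "glued_verts n Q = (SIGMA m : {1..n}. verts (Q m))"

definition glued_edges :: "nat \<Rightarrow> (nat \<Rightarrow> ('q, 'a) pre_digraph) \<Rightarrow> 'a edge set" where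
  "glued_edges n Q = {Inner m \<alpha> | m \<alpha>. m \<in> {1..n} \<and> \<alpha> \<in> arcs (Q m)} \<union>
     {Link m \<gamma> \<gamma>' | m \<gamma> \<gamma>'. m \<in> {2..n} \<and> \<gamma> \<in> arcs (Q (m - 1)) \<and> \<gamma>' \<in> arcs (Q m)}"

fun edge_src :: "(nat \<Rightarrow> ('q, 'a) pre_digraph) \<Rightarrow> 'a edge \<Rightarrow> nat \<times> 'q" where
  "edge_src Q (Inner m \<alpha>) = (m, tail (Q m) \<alpha>)"
| "edge_src Q (Link m \<gamma> \<gamma>') = (m - 1, head (Q (m - 1)) \<gamma>)"

fun edge_tgt :: "(nat \<Rightarrow> ('q, 'a) pre_digraph) \<Rightarrow> 'a edge \<Rightarrow> nat \<times> 'q" where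
  "edge_tgt Q (Inner m \<alpha>) = (m, head (Q m) \<alpha>)"
| "edge_tgt Q (Link m \<gamma> \<gamma>') = (m, tail (Q m) \<gamma>')"

text \<open>The vector space of an n-representation at a vertex, and its linear map along an arrow.\<close>

definition space_at :: "('k, 'v, 'q, 'a) nrep \<Rightarrow> nat \<times> 'q \<Rightarrow> ('k, 'v) module" where
  "space_at V p = space (rep V (fst p)) (snd p)"

fun edge_map :: "('k, 'v, 'q, 'a) nrep \<Rightarrow> 'a edge \<Rightarrow> 'v \<Rightarrow> 'v" where
  "edge_map V (Inner m \<alpha>) = arrow_map (rep V m) \<alpha>"
| "edge_map V (Link m \<gamma> \<gamma>') = psi V m \<gamma> \<gamma>'"

text \<open>The component of a morphism at a vertex of the glued quiver.\<close>

definition cmpt :: "(nat \<Rightarrow> 'q \<Rightarrow> 'v \<Rightarrow> 'v) \<Rightarrow> nat \<times> 'q \<Rightarrow> 'v \<Rightarrow> 'v" where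
  "cmpt f p = f (fst p) (snd p)"

text \<open>Quivers over a field whose arrows start and end at vertices; the number of quivers is arbitrary.\<close>

locale glued_quiver = field k for k :: "('k, 'r) ring_scheme" (structure) +
  fixes n :: nat and Q :: "nat \<Rightarrow> ('q, 'a) pre_digraph"
  assumes wf: "m \<in> {1..n} \<Longrightarrow> wf_digraph (Q m)"
begin

abbreviation "P \<equiv> glued_verts n Q"
abbreviation "E \<equiv> glued_edges n Q"
abbreviation "src \<equiv> edge_src Q"
abbreviation "tgt \<equiv> edge_tgt Q"

lemma ball_E:
  "(\<forall>e \<in> E. R e) \<longleftrightarrow> (\<forall>m \<in> {1..n}. \<forall>\<alpha> \<in> arcs (Q m). R (Inner m \<alpha>)) \<and>
     (\<forall>m \<in> {2..n}. \<forall>\<gamma> \<in> arcs (Q (m - 1)). \<forall>\<gamma>' \<in> arcs (Q m). R (Link m \<gamma> \<gamma>'))"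
  unfolding glued_edges_def by blast

lemma ball_P: "(\<forall>p \<in> P. R p) \<longleftrightarrow> (\<forall>m \<in> {1..n}. \<forall>i \<in> verts (Q m). R (m, i))"
  unfolding glued_verts_def by blast

lemma endpoints: "\<forall>e \<in> E. src e \<in> P \<and> tgt e \<in> P"
proof -
  have "Suc 0 \<le> m - Suc 0" "m - Suc 0 \<le> n" if "2 \<le> m" "m \<le> n" for m
    using that by auto
  then show ?thesis
    unfolding ball_E glued_verts_def
    using wf_digraph.tail_in_verts[OF wf] wf_digraph.head_in_verts[OF wf] by auto
qed

lemma src_in_P: "e \<in> E \<Longrightarrow> src e \<in> P" and tgt_in_P: "e \<in> E \<Longrightarrow> tgt e \<in> P"
  using endpoints by blast+

lemma nrepsD:
  assumes "V \<in> nreps k n Q"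
  shows space_at_module: "p \<in> P \<Longrightarrow> module k (space_at V p)"
    and edge_map_linear:
      "e \<in> E \<Longrightarrow> edge_map V e \<in> linear_maps k (space_at V (src e)) (space_at V (tgt e))"
proof -
  have rep: "rep V m \<in> qreps k (Q m)" if "m \<in> {1..n}" for m
    using assms that unfolding nreps_def by blast
  show "module k (space_at V p)" if "p \<in> P"
    using that rep by (force simp: glued_verts_def space_at_def qreps_def)
  have psi: "psi V m \<gamma> \<gamma>' \<in> linear_maps k (space (rep V (m - 1)) (head (Q (m - 1)) \<gamma>))
        (space (rep V m) (tail (Q m) \<gamma>'))"
    if "m \<in> {2..n}" "\<gamma> \<in> arcs (Q (m - 1))" "\<gamma>' \<in> arcs (Q m)" for m \<gamma> \<gamma>'
  proof -
    have "psi V \<in> (\<Pi>\<^sub>E m \<in> {2..n}. \<Pi>\<^sub>E \<gamma> \<in> arcs (Q (m - 1)). \<Pi>\<^sub>E \<gamma>' \<in> arcs (Q m).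
              linear_maps k (space (rep V (m - 1)) (head (Q (m - 1)) \<gamma>))
                            (space (rep V m) (tail (Q m) \<gamma>')))"
      using assms unfolding nreps_def by blast
    then show ?thesis using that by (meson PiE_mem)
  qed
  show "edge_map V e \<in> linear_maps k (space_at V (src e)) (space_at V (tgt e))" if "e \<in> E"
  proof -
    have "arrow_map (rep V m) \<alpha> \<in> linear_maps k (space (rep V m) (tail (Q m) \<alpha>))
        (space (rep V m) (head (Q m) \<alpha>))" if "m \<in> {1..n}" "\<alpha> \<in> arcs (Q m)" for m \<alpha>
      using rep[OF that(1)] PiE_mem[OF _ that(2)] unfolding qreps_def by blast
    then have "\<forall>e \<in> E. edge_map V e \<in> linear_maps k (space_at V (src e)) (space_at V (tgt e))"
      unfolding ball_E space_at_def using psi by auto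
    then show ?thesis using that by blast
  qed
qed

text \<open>Any choice of vector spaces and of linear maps along the arrows is realised by an n-representation.\<close>

lemma nreps_build:
  fixes S :: "nat \<times> 'q \<Rightarrow> ('k, 'v) module"
  assumes S: "\<And>p. p \<in> P \<Longrightarrow> module k (S p)"
    and A: "\<And>e. e \<in> E \<Longrightarrow> A e \<in> linear_maps k (S (src e)) (S (tgt e))"
  obtains V where "V \<in> nreps k n Q" "\<And>p. p \<in> P \<Longrightarrow> space_at V p = S p"
    "\<And>e. e \<in> E \<Longrightarrow> edge_map V e = A e"
proof -
  define V :: "('k, 'v, 'q, 'a) nrep" where
    "V = \<lparr>rep = (\<lambda>m \<in> {1..n}. \<lparr>space = (\<lambda>i \<in> verts (Q m). S (m, i)),
                            arrow_map = (\<lambda>\<alpha> \<in> arcs (Q m). A (Inner m \<alpha>))\<rparr>),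
          psi = (\<lambda>m \<in> {2..n}. \<lambda>\<gamma> \<in> arcs (Q (m - 1)). \<lambda>\<gamma>' \<in> arcs (Q m). A (Link m \<gamma> \<gamma>'))\<rparr>"
  have sp: "space_at V p = S p" if "p \<in> P" for p
    using that by (auto simp: V_def space_at_def glued_verts_def)
  have ed: "edge_map V e = A e" if "e \<in> E" for e
    using that by (auto simp: V_def glued_edges_def)
  have "rep V m \<in> qreps k (Q m)" if m: "m \<in> {1..n}" for m
  proof -
    have "module k (S (m, i))" if "i \<in> verts (Q m)" for i
      using S m that by (simp add: glued_verts_def)
    moreover have "A (Inner m \<alpha>) \<in> linear_maps k (S (m, tail (Q m) \<alpha>)) (S (m, head (Q m) \<alpha>))"
      if "\<alpha> \<in> arcs (Q m)" for \<alpha>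
      using A[of "Inner m \<alpha>"] m that by (simp add: glued_edges_def)
    ultimately show ?thesis
      using m wf_digraph.tail_in_verts[OF wf[OF m]] wf_digraph.head_in_verts[OF wf[OF m]]
      by (simp add: qreps_def V_def)
  qed
  moreover have "psi V m \<gamma> \<gamma>' \<in> linear_maps k (space (rep V (m - 1)) (head (Q (m - 1)) \<gamma>))
        (space (rep V m) (tail (Q m) \<gamma>'))"
    if m: "m \<in> {2..n}" and \<gamma>: "\<gamma> \<in> arcs (Q (m - 1))" "\<gamma>' \<in> arcs (Q m)" for m \<gamma> \<gamma>'
  proof -
    have e: "Link m \<gamma> \<gamma>' \<in> E" using that by (auto simp: glued_edges_def)
    show ?thesis
      using A[OF e] ed[OF e] sp[OF src_in_P[OF e]] sp[OF tgt_in_P[OF e]]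
      by (simp add: space_at_def)
  qed
  moreover have "rep V \<in> extensional {1..n}" "psi V \<in> extensional {2..n}"
    "m \<in> {2..n} \<Longrightarrow> psi V m \<in> extensional (arcs (Q (m - 1)))"
    "m \<in> {2..n} \<Longrightarrow> \<gamma> \<in> arcs (Q (m - 1)) \<Longrightarrow> psi V m \<gamma> \<in> extensional (arcs (Q m))" for m \<gamma>
    by (simp_all add: V_def)
  ultimately have "V \<in> nreps k n Q"
    by (simp add: nreps_def PiE_iff)
  then show ?thesis using sp ed that by blast
qed

text \<open>
  Morphisms are the commuting families of linear maps; the first two conditions on the right say
  that the family is \<^const>\<open>undefined\<close> off the vertices.
\<close>

lemma nrep_hom_iff:
  "f \<in> nrep_hom k n Q V W \<longleftrightarrow>
    f \<in> extensional {1..n} \<and> (\<forall>m \<in> {1..n}. f m \<in> extensional (verts (Q m))) \<and>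
    (\<forall>p \<in> P. cmpt f p \<in> linear_maps k (space_at V p) (space_at W p)) \<and>
    (\<forall>e \<in> E. \<forall>x \<in> carrier (space_at V (src e)).
       cmpt f (tgt e) (edge_map V e x) = edge_map W e (cmpt f (src e) x))"
proof -
  have comp_eq: "compose A g h = compose A g' h' \<longleftrightarrow> (\<forall>x \<in> A. g (h x) = g' (h' x))"
    for A :: "'b set" and g g' :: "'c \<Rightarrow> 'd" and h h'
    by (auto simp: compose_def fun_eq_iff restrict_def)
  show ?thesis
    unfolding nrep_hom_def qrep_hom_def comp_eq ball_E ball_P PiE_iff cmpt_def space_at_def
      edge_src.simps edge_tgt.simps edge_map.simps fst_conv snd_conv mem_Collect_eq ball_conj_distrib
    by blast
qed


lemma nrep_hom_linear:
  "\<lbrakk>f \<in> nrep_hom k n Q V W; p \<in> P\<rbrakk> \<Longrightarrow> cmpt f p \<in> linear_maps k (space_at V p) (space_at W p)"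
  by (simp add: nrep_hom_iff)

lemma nrep_hom_commute:
  "\<lbrakk>f \<in> nrep_hom k n Q V W; e \<in> E; x \<in> carrier (space_at V (src e))\<rbrakk>
    \<Longrightarrow> cmpt f (tgt e) (edge_map V e x) = edge_map W e (cmpt f (src e) x)"
  by (simp add: nrep_hom_iff)

lemma nrep_hom_closed:
  "\<lbrakk>f \<in> nrep_hom k n Q V W; p \<in> P; x \<in> carrier (space_at V p)\<rbrakk>
    \<Longrightarrow> cmpt f p x \<in> carrier (space_at W p)"
  by (rule linear_maps_closed[OF nrep_hom_linear])

lemma edge_map_closed:
  "\<lbrakk>V \<in> nreps k n Q; e \<in> E; x \<in> carrier (space_at V (src e))\<rbrakk>
    \<Longrightarrow> edge_map V e x \<in> carrier (space_at V (tgt e))"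
  by (rule linear_maps_closed[OF edge_map_linear])

lemma nrep_hom_eqI:
  assumes f: "f \<in> nrep_hom k n Q V W" and g: "g \<in> nrep_hom k n Q V W"
    and eq: "\<And>p x. p \<in> P \<Longrightarrow> x \<in> carrier (space_at V p) \<Longrightarrow> cmpt f p x = cmpt g p x"
  shows "f = g"
proof (rule extensionalityI)
  show "f \<in> extensional {1..n}" "g \<in> extensional {1..n}"
    using f g by (simp_all add: nrep_hom_iff)
  fix m assume m: "m \<in> {1..n}"
  show "f m = g m"
  proof (rule extensionalityI)
    show "f m \<in> extensional (verts (Q m))" "g m \<in> extensional (verts (Q m))"
      using f g m by (simp_all add: nrep_hom_iff)
    fix i assume "i \<in> verts (Q m)"
    then have p: "(m, i) \<in> P" using m by (simp add: glued_verts_def)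
    have "cmpt f (m, i) = cmpt g (m, i)"
      using linear_maps_extensional[OF nrep_hom_linear[OF f p]]
        linear_maps_extensional[OF nrep_hom_linear[OF g p]] eq[OF p]
      by (rule extensionalityI)
    then show "f m i = g m i" by (simp add: cmpt_def)
  qed
qed

lemma nrep_hom_exists:
  assumes lin: "\<And>p. p \<in> P \<Longrightarrow> G p \<in> linear_maps k (space_at V p) (space_at W p)"
    and comm: "\<And>e x. \<lbrakk>e \<in> E; x \<in> carrier (space_at V (src e))\<rbrakk>
      \<Longrightarrow> G (tgt e) (edge_map V e x) = edge_map W e (G (src e) x)"
  obtains f where "f \<in> nrep_hom k n Q V W" "\<And>p. p \<in> P \<Longrightarrow> cmpt f p = G p"
proof -
  define f where "f = (\<lambda>m \<in> {1..n}. \<lambda>i \<in> verts (Q m). G (m, i))"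
  have cmpt_f: "cmpt f p = G p" if "p \<in> P" for p
    using that by (auto simp: f_def cmpt_def glued_verts_def)
  have "f \<in> nrep_hom k n Q V W"
    unfolding nrep_hom_iff using lin comm src_in_P tgt_in_P
    by (simp add: cmpt_f) (simp add: f_def)
  with cmpt_f that show ?thesis by blast
qed

lemma cmpt_family:
  "p \<in> P \<Longrightarrow> cmpt (nrep_family n Q V F) p = (\<lambda>x \<in> carrier (space_at V p). F (fst p) (snd p) x)"
  by (auto simp: cmpt_def nrep_family_def space_at_def glued_verts_def)

text \<open>
  The function \<open>G\<close> is \<open>F\<close> written in terms of vertices of the glued quiver.
\<close>

lemma nrep_family_hom:
  assumes V: "V \<in> nreps k n Q"
    and F: "\<And>p x. F (fst p) (snd p) x = G p x"
    and lin: "\<And>p. p \<in> P \<Longrightarrow> restrict (G p) (carrier (space_at V p)) \<in> linear_maps k (space_at V p) (space_at W p)"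
    and comm: "\<And>e x. \<lbrakk>e \<in> E; x \<in> carrier (space_at V (src e))\<rbrakk>
      \<Longrightarrow> G (tgt e) (edge_map V e x) = edge_map W e (G (src e) x)"
  shows "nrep_family n Q V F \<in> nrep_hom k n Q V W"
proof -
  have "cmpt (nrep_family n Q V F) p = restrict (G p) (carrier (space_at V p))" if "p \<in> P" for p
    using that by (simp add: cmpt_family F)
  then show ?thesis
    unfolding nrep_hom_iff using lin comm src_in_P tgt_in_P edge_map_closed[OF V]
    by simp (simp add: nrep_family_def)
qed

section \<open>The linear structure on n-representations\<close>

abbreviation "C \<equiv> nRep k n Q"

lemma nRep_simps [simp]:
  "Obj C = nreps k n Q" "carrier (Hom C V W) = nrep_hom k n Q V W"
  by (simp_all add: nRep_def nrep_Hom_def)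

text \<open>
  All operations of the category are pointwise.  Together with \<open>nrep_hom_eqI\<close> this reduces every
  equation between morphisms to one between vectors.
\<close>

lemma cmpt_ops:
  assumes "p \<in> P" "x \<in> carrier (space_at V p)"
  shows cmpt_Cmp: "cmpt (Cmp C V V' W g f) p x = cmpt g p (cmpt f p x)"
    and cmpt_Idn: "cmpt (Idn C V) p x = x"
    and cmpt_zero: "cmpt \<zero>\<^bsub>Hom C V W\<^esub> p x = \<zero>\<^bsub>space_at W p\<^esub>"
    and cmpt_add: "cmpt (f \<oplus>\<^bsub>Hom C V W\<^esub> g) p x = cmpt f p x \<oplus>\<^bsub>space_at W p\<^esub> cmpt g p x"
    and cmpt_smult: "cmpt (a \<odot>\<^bsub>Hom C V W\<^esub> f) p x = a \<odot>\<^bsub>space_at W p\<^esub> cmpt f p x"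
  using assms by (simp_all add: nRep_def nrep_Hom_def cmpt_family)
    (simp_all add: cmpt_def space_at_def)

lemma Cmp_hom:
  assumes V: "V \<in> nreps k n Q" and f: "f \<in> nrep_hom k n Q V V'" and g: "g \<in> nrep_hom k n Q V' W"
  shows "Cmp C V V' W g f \<in> nrep_hom k n Q V W"
proof -
  have "nrep_family n Q V (\<lambda>m i x. g m i (f m i x)) \<in> nrep_hom k n Q V W"
  proof (rule nrep_family_hom[OF V, where G = "\<lambda>p x. cmpt g p (cmpt f p x)"])
    fix p assume "p \<in> P"
    then show "(\<lambda>x \<in> carrier (space_at V p). cmpt g p (cmpt f p x))
        \<in> linear_maps k (space_at V p) (space_at W p)"
      by (intro linear_maps_compose[OF space_at_module[OF V] nrep_hom_linear[OF f] nrep_hom_linear[OF g]])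
  next
    fix e x assume e: "e \<in> E" "x \<in> carrier (space_at V (src e))"
    then show "cmpt g (tgt e) (cmpt f (tgt e) (edge_map V e x)) =
        edge_map W e (cmpt g (src e) (cmpt f (src e) x))"
      using nrep_hom_commute[OF f e] nrep_hom_commute[OF g e(1)]
        nrep_hom_closed[OF f src_in_P[OF e(1)] e(2)] by simp
  qed (simp add: cmpt_def)
  then show ?thesis by (simp add: nRep_def)
qed

lemma Idn_hom:
  assumes V: "V \<in> nreps k n Q"
  shows "Idn C V \<in> nrep_hom k n Q V V"
  using nrep_family_hom[OF V, of "\<lambda>m i x. x" "\<lambda>p x. x" V] linear_maps_ident[OF space_at_module[OF V]]
  by (simp add: nRep_def)

lemma edge_map_zero:
  assumes "V \<in> nreps k n Q" "e \<in> E"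
  shows "edge_map V e \<zero>\<^bsub>space_at V (src e)\<^esub> = \<zero>\<^bsub>space_at V (tgt e)\<^esub>"
  by (intro linear_maps_zero[OF space_at_module space_at_module edge_map_linear] assms src_in_P tgt_in_P)

lemma nrep_hom_zero:
  assumes "V \<in> nreps k n Q" "W \<in> nreps k n Q" "f \<in> nrep_hom k n Q V W" "p \<in> P"
  shows "cmpt f p \<zero>\<^bsub>space_at V p\<^esub> = \<zero>\<^bsub>space_at W p\<^esub>"
  by (rule linear_maps_zero[OF space_at_module space_at_module nrep_hom_linear]) fact+

context
  fixes V W :: "('k, 'v, 'q, 'a) nrep"
  assumes V: "V \<in> nreps k n Q" and W: "W \<in> nreps k n Q"
begin

lemma zero_hom: "\<zero>\<^bsub>Hom C V W\<^esub> \<in> nrep_hom k n Q V W"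
proof -
  have "nrep_family n Q V (\<lambda>m i x. \<zero>\<^bsub>space (rep W m) i\<^esub>) \<in> nrep_hom k n Q V W"
  proof (rule nrep_family_hom[OF V, where G = "\<lambda>p x. \<zero>\<^bsub>space_at W p\<^esub>"])
    fix p assume "p \<in> P"
    then show "(\<lambda>x \<in> carrier (space_at V p). \<zero>\<^bsub>space_at W p\<^esub>)
        \<in> linear_maps k (space_at V p) (space_at W p)"
      by (intro linear_maps_zero_map[OF space_at_module[OF V] space_at_module[OF W]])
  qed (simp_all add: space_at_def edge_map_zero[OF W, unfolded space_at_def])
  then show ?thesis by (simp add: nRep_def nrep_Hom_def)
qed

lemma add_hom:
  assumes f: "f \<in> nrep_hom k n Q V W" and g: "g \<in> nrep_hom k n Q V W"
  shows "f \<oplus>\<^bsub>Hom C V W\<^esub> g \<in> nrep_hom k n Q V W"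
proof -
  have "nrep_family n Q V (\<lambda>m i x. f m i x \<oplus>\<^bsub>space (rep W m) i\<^esub> g m i x) \<in> nrep_hom k n Q V W"
  proof (rule nrep_family_hom[OF V, where G = "\<lambda>p x. cmpt f p x \<oplus>\<^bsub>space_at W p\<^esub> cmpt g p x"])
    fix p assume "p \<in> P"
    then show "(\<lambda>x \<in> carrier (space_at V p). cmpt f p x \<oplus>\<^bsub>space_at W p\<^esub> cmpt g p x)
        \<in> linear_maps k (space_at V p) (space_at W p)"
      by (intro linear_maps_sum[OF space_at_module[OF V] space_at_module[OF W]
            nrep_hom_linear[OF f] nrep_hom_linear[OF g]])
  next
    fix e x assume e: "e \<in> E" "x \<in> carrier (space_at V (src e))"
    then show "cmpt f (tgt e) (edge_map V e x) \<oplus>\<^bsub>space_at W (tgt e)\<^esub> cmpt g (tgt e) (edge_map V e x) =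
        edge_map W e (cmpt f (src e) x \<oplus>\<^bsub>space_at W (src e)\<^esub> cmpt g (src e) x)"
      using nrep_hom_commute[OF f e] nrep_hom_commute[OF g e] src_in_P[OF e(1)]
        linear_maps_add[OF edge_map_linear[OF W e(1)]] nrep_hom_closed[OF f] nrep_hom_closed[OF g]
      by simp
  qed (simp add: cmpt_def space_at_def)
  then show ?thesis by (simp add: nRep_def nrep_Hom_def)
qed

lemma smult_hom:
  assumes f: "f \<in> nrep_hom k n Q V W" and a: "a \<in> carrier k"
  shows "a \<odot>\<^bsub>Hom C V W\<^esub> f \<in> nrep_hom k n Q V W"
proof -
  have "nrep_family n Q V (\<lambda>m i x. a \<odot>\<^bsub>space (rep W m) i\<^esub> f m i x) \<in> nrep_hom k n Q V W"
  proof (rule nrep_family_hom[OF V, where G = "\<lambda>p x. a \<odot>\<^bsub>space_at W p\<^esub> cmpt f p x"])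
    fix p assume "p \<in> P"
    then show "(\<lambda>x \<in> carrier (space_at V p). a \<odot>\<^bsub>space_at W p\<^esub> cmpt f p x)
        \<in> linear_maps k (space_at V p) (space_at W p)"
      by (intro linear_maps_scale[OF space_at_module[OF V] space_at_module[OF W]
            nrep_hom_linear[OF f] a])
  next
    fix e x assume e: "e \<in> E" "x \<in> carrier (space_at V (src e))"
    then show "a \<odot>\<^bsub>space_at W (tgt e)\<^esub> cmpt f (tgt e) (edge_map V e x) =
        edge_map W e (a \<odot>\<^bsub>space_at W (src e)\<^esub> cmpt f (src e) x)"
      using nrep_hom_commute[OF f e] src_in_P[OF e(1)]
        linear_maps_smult[OF edge_map_linear[OF W e(1)] a] nrep_hom_closed[OF f]
      by simp
  qed (simp add: cmpt_def space_at_def)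
  then show ?thesis by (simp add: nRep_def nrep_Hom_def)
qed

lemma Hom_module: "module k (Hom C V W)"
proof -
  note W_module = space_at_module[OF W]
  have "abelian_group (Hom C V W)"
  proof (rule abelian_groupI)
    fix f g h assume fgh: "f \<in> carrier (Hom C V W)" "g \<in> carrier (Hom C V W)" "h \<in> carrier (Hom C V W)"
    show "f \<oplus>\<^bsub>Hom C V W\<^esub> g \<oplus>\<^bsub>Hom C V W\<^esub> h = f \<oplus>\<^bsub>Hom C V W\<^esub> (g \<oplus>\<^bsub>Hom C V W\<^esub> h)"
      by (rule nrep_hom_eqI[of _ V W])
        (use fgh in \<open>auto simp: add_hom cmpt_add nrep_hom_closed[where V = V]
          abelian_monoid.a_assoc[OF abelian_group.axioms(1)[OF module.axioms(2)[OF W_module]]]\<close>)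
  next
    fix f g assume fg: "f \<in> carrier (Hom C V W)" "g \<in> carrier (Hom C V W)"
    show "f \<oplus>\<^bsub>Hom C V W\<^esub> g = g \<oplus>\<^bsub>Hom C V W\<^esub> f"
      by (rule nrep_hom_eqI[of _ V W])
        (use fg in \<open>auto simp: add_hom cmpt_add nrep_hom_closed[where V = V]
          abelian_monoid.a_comm[OF abelian_group.axioms(1)[OF module.axioms(2)[OF W_module]]]\<close>)
  next
    fix f assume f: "f \<in> carrier (Hom C V W)"
    show "\<zero>\<^bsub>Hom C V W\<^esub> \<oplus>\<^bsub>Hom C V W\<^esub> f = f"
      by (rule nrep_hom_eqI[of _ V W])
        (use f in \<open>auto simp: add_hom zero_hom cmpt_add cmpt_zero nrep_hom_closed[where V = V]
          abelian_monoid.l_zero[OF abelian_group.axioms(1)[OF module.axioms(2)[OF W_module]]]\<close>)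
    \<comment> \<open>The additive inverse of a morphism is its multiple by $-1$.\<close>
    let ?neg = "(\<ominus> \<one>) \<odot>\<^bsub>Hom C V W\<^esub> f"
    have neg: "(\<ominus> \<one>) \<odot>\<^bsub>space_at W p\<^esub> x \<oplus>\<^bsub>space_at W p\<^esub> x = \<zero>\<^bsub>space_at W p\<^esub>"
      if "p \<in> P" "x \<in> carrier (space_at W p)" for p x
    proof -
      interpret W: module k "space_at W p" using W_module that(1) .
      show ?thesis using that(2) by (simp flip: W.neg_eq_smult add: W.M.l_neg)
    qed
    have "?neg \<oplus>\<^bsub>Hom C V W\<^esub> f = \<zero>\<^bsub>Hom C V W\<^esub>"
      by (rule nrep_hom_eqI[of _ V W])
        (use f in \<open>auto simp: add_hom zero_hom smult_hom cmpt_add cmpt_zero cmpt_smult nrep_hom_closed[where V = V] neg\<close>)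
    then show "\<exists>g \<in> carrier (Hom C V W). g \<oplus>\<^bsub>Hom C V W\<^esub> f = \<zero>\<^bsub>Hom C V W\<^esub>"
      using f by (intro bexI[of _ ?neg]) (auto simp: smult_hom)
  qed (auto simp: zero_hom add_hom)
  then show ?thesis
  proof (rule moduleI[OF is_cring])
    fix a b f assume abf: "a \<in> carrier k" "b \<in> carrier k" "f \<in> carrier (Hom C V W)"
    show "(a \<oplus> b) \<odot>\<^bsub>Hom C V W\<^esub> f = a \<odot>\<^bsub>Hom C V W\<^esub> f \<oplus>\<^bsub>Hom C V W\<^esub> b \<odot>\<^bsub>Hom C V W\<^esub> f"
      by (rule nrep_hom_eqI[of _ V W])
        (use abf in \<open>auto simp: add_hom smult_hom cmpt_add cmpt_smult nrep_hom_closed[where V = V]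
          module.smult_l_distr[OF W_module]\<close>)
    show "(a \<otimes> b) \<odot>\<^bsub>Hom C V W\<^esub> f = a \<odot>\<^bsub>Hom C V W\<^esub> (b \<odot>\<^bsub>Hom C V W\<^esub> f)"
      by (rule nrep_hom_eqI[of _ V W])
        (use abf in \<open>auto simp: smult_hom cmpt_smult nrep_hom_closed[where V = V]
          module.smult_assoc1[OF W_module]\<close>)
  next
    fix a f g assume afg: "a \<in> carrier k" "f \<in> carrier (Hom C V W)" "g \<in> carrier (Hom C V W)"
    show "a \<odot>\<^bsub>Hom C V W\<^esub> (f \<oplus>\<^bsub>Hom C V W\<^esub> g) = a \<odot>\<^bsub>Hom C V W\<^esub> f \<oplus>\<^bsub>Hom C V W\<^esub> a \<odot>\<^bsub>Hom C V W\<^esub> g"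
      by (rule nrep_hom_eqI[of _ V W])
        (use afg in \<open>auto simp: add_hom smult_hom cmpt_add cmpt_smult nrep_hom_closed[where V = V]
          module.smult_r_distr[OF W_module]\<close>)
  next
    fix f assume f: "f \<in> carrier (Hom C V W)"
    show "\<one> \<odot>\<^bsub>Hom C V W\<^esub> f = f"
      by (rule nrep_hom_eqI[of _ V W])
        (use f in \<open>auto simp: smult_hom cmpt_smult nrep_hom_closed[where V = V] module.smult_one[OF W_module]\<close>)
  qed (auto simp: smult_hom)
qed

end

lemma category_nRep: "category C"
proof
  fix A B D :: "('k, 'v, 'q, 'a) nrep" and f g
  assume "A \<in> Obj C" "B \<in> Obj C" "D \<in> Obj C" "f \<in> carrier (Hom C A B)" "g \<in> carrier (Hom C B D)"
  then show "Cmp C A B D g f \<in> carrier (Hom C A D)"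
    by (simp add: Cmp_hom)
next
  fix A B D E :: "('k, 'v, 'q, 'a) nrep" and f g h
  assume *: "A \<in> Obj C" "B \<in> Obj C" "D \<in> Obj C" "E \<in> Obj C"
    "f \<in> carrier (Hom C A B)" "g \<in> carrier (Hom C B D)" "h \<in> carrier (Hom C D E)"
  show "Cmp C A B E (Cmp C B D E h g) f = Cmp C A D E h (Cmp C A B D g f)"
    by (rule nrep_hom_eqI[of _ A E])
      (use * in \<open>auto intro!: Cmp_hom[of A _ B] Cmp_hom[of A _ D] Cmp_hom[of B _ D]
        simp: cmpt_Cmp nrep_hom_closed[of f A B]\<close>)
next
  fix A :: "('k, 'v, 'q, 'a) nrep" assume "A \<in> Obj C"
  then show "Idn C A \<in> carrier (Hom C A A)" by (simp add: Idn_hom)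
next
  fix A B :: "('k, 'v, 'q, 'a) nrep" and f
  assume *: "A \<in> Obj C" "B \<in> Obj C" "f \<in> carrier (Hom C A B)"
  show "Cmp C A B B (Idn C B) f = f"
    by (rule nrep_hom_eqI[of _ A B])
      (use * in \<open>auto intro!: Cmp_hom[of A _ B] Idn_hom simp: cmpt_Cmp cmpt_Idn nrep_hom_closed[of f A B]\<close>)
  show "Cmp C A A B f (Idn C A) = f"
    by (rule nrep_hom_eqI[of _ A B])
      (use * in \<open>auto intro!: Cmp_hom[of A _ A] Idn_hom simp: cmpt_Cmp cmpt_Idn\<close>)
qed


lemma Cmp_bilinear:
  fixes A B D :: "('k, 'v, 'q, 'a) nrep"
  assumes obj: "A \<in> nreps k n Q" "B \<in> nreps k n Q" "D \<in> nreps k n Q"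
    and f: "f \<in> nrep_hom k n Q A B" "f' \<in> nrep_hom k n Q A B"
    and g: "g \<in> nrep_hom k n Q B D" "g' \<in> nrep_hom k n Q B D"
    and a: "a \<in> carrier k"
  shows Cmp_add_left: "Cmp C A B D (g \<oplus>\<^bsub>Hom C B D\<^esub> g') f = Cmp C A B D g f \<oplus>\<^bsub>Hom C A D\<^esub> Cmp C A B D g' f"
    and Cmp_add_right: "Cmp C A B D g (f \<oplus>\<^bsub>Hom C A B\<^esub> f') = Cmp C A B D g f \<oplus>\<^bsub>Hom C A D\<^esub> Cmp C A B D g f'"
    and Cmp_smult_left: "Cmp C A B D (a \<odot>\<^bsub>Hom C B D\<^esub> g) f = a \<odot>\<^bsub>Hom C A D\<^esub> Cmp C A B D g f"
    and Cmp_smult_right: "Cmp C A B D g (a \<odot>\<^bsub>Hom C A B\<^esub> f) = a \<odot>\<^bsub>Hom C A D\<^esub> Cmp C A B D g f"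
proof -
  note homs = add_hom[OF obj(1,2)] add_hom[OF obj(2,3)] add_hom[OF obj(1,3)]
    smult_hom[OF obj(1,2)] smult_hom[OF obj(2,3)] smult_hom[OF obj(1,3)]
    Cmp_hom[OF obj(1), of _ B _ D] f g a
  note eval = cmpt_Cmp cmpt_add cmpt_smult nrep_hom_closed[OF f(1)] nrep_hom_closed[OF f(2)]
    linear_maps_add[OF nrep_hom_linear[OF g(1)]] linear_maps_smult[OF nrep_hom_linear[OF g(1)] a]
  show "Cmp C A B D (g \<oplus>\<^bsub>Hom C B D\<^esub> g') f = Cmp C A B D g f \<oplus>\<^bsub>Hom C A D\<^esub> Cmp C A B D g' f"
    by (rule nrep_hom_eqI[of _ A D]) (simp_all add: homs eval)
  show "Cmp C A B D g (f \<oplus>\<^bsub>Hom C A B\<^esub> f') = Cmp C A B D g f \<oplus>\<^bsub>Hom C A D\<^esub> Cmp C A B D g f'"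
    by (rule nrep_hom_eqI[of _ A D]) (simp_all add: homs eval)
  show "Cmp C A B D (a \<odot>\<^bsub>Hom C B D\<^esub> g) f = a \<odot>\<^bsub>Hom C A D\<^esub> Cmp C A B D g f"
    by (rule nrep_hom_eqI[of _ A D]) (simp_all add: homs eval)
  show "Cmp C A B D g (a \<odot>\<^bsub>Hom C A B\<^esub> f) = a \<odot>\<^bsub>Hom C A D\<^esub> Cmp C A B D g f"
    by (rule nrep_hom_eqI[of _ A D]) (simp_all add: homs eval)
qed

section \<open>Zero object and direct sums\<close>

lemma zero_object_exists: "\<exists>Z. is_zero_object C (Z :: ('k, 'v, 'q, 'a) nrep)"
proof -
  define S :: "('k, 'v) module" where
    "S = \<lparr>carrier = {undefined}, monoid.mult = undefined, one = undefined,
          ring.zero = undefined, add = (\<lambda>_ _. undefined), smult = (\<lambda>_ _. undefined)\<rparr>"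
  have "abelian_group S"
    by (rule abelian_groupI) (auto simp: S_def)
  then have S: "module k S"
    by (intro moduleI is_cring) (auto simp: S_def)
  obtain Z :: "('k, 'v, 'q, 'a) nrep" where Z: "Z \<in> nreps k n Q" "\<And>p. p \<in> P \<Longrightarrow> space_at Z p = S"
    using nreps_build[of "\<lambda>_. S" "\<lambda>_. \<lambda>x \<in> carrier S. x"] S linear_maps_ident[OF S] by metis
  have Z_carrier: "x = \<zero>\<^bsub>space_at Z p\<^esub>" if "p \<in> P" "x \<in> carrier (space_at Z p)" for p x
    using that by (simp add: Z(2) S_def)
  have "is_zero_object C Z"
    unfolding is_zero_object_def nRep_simps
  proof (intro conjI ballI Z(1))
    fix A :: "('k, 'v, 'q, 'a) nrep" assume A: "A \<in> nreps k n Q"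
    show "\<exists>!f. f \<in> nrep_hom k n Q Z A"
    proof (rule ex1I[where a = "\<zero>\<^bsub>Hom C Z A\<^esub>"])
      fix f assume f: "f \<in> nrep_hom k n Q Z A"
      show "f = \<zero>\<^bsub>Hom C Z A\<^esub>"
      proof (rule nrep_hom_eqI[OF f zero_hom[OF Z(1) A]])
        fix p x assume p: "p \<in> P" and x: "x \<in> carrier (space_at Z p)"
        show "cmpt f p x = cmpt \<zero>\<^bsub>Hom C Z A\<^esub> p x"
          unfolding cmpt_zero[OF p x] using Z_carrier[OF p x] nrep_hom_zero[OF Z(1) A f p] by simp
      qed
    qed (rule zero_hom[OF Z(1) A])
    show "\<exists>!f. f \<in> nrep_hom k n Q A Z"
    proof (rule ex1I[where a = "\<zero>\<^bsub>Hom C A Z\<^esub>"])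
      fix f assume f: "f \<in> nrep_hom k n Q A Z"
      show "f = \<zero>\<^bsub>Hom C A Z\<^esub>"
      proof (rule nrep_hom_eqI[OF f zero_hom[OF A Z(1)]])
        fix p x assume p: "p \<in> P" and x: "x \<in> carrier (space_at A p)"
        show "cmpt f p x = cmpt \<zero>\<^bsub>Hom C A Z\<^esub> p x"
          unfolding cmpt_zero[OF p x] by (rule Z_carrier[OF p nrep_hom_closed[OF f p x]])
      qed
    qed (rule zero_hom[OF A Z(1)])
  qed
  then show ?thesis by blast
qed

lemma direct_sum_exists:
  fixes A B :: "('k, 'v, 'q, 'a) nrep"
  assumes inf: "infinite (carrier k)" and A: "A \<in> nreps k n Q" and B: "B \<in> nreps k n Q"
  shows "\<exists>S i\<^sub>1 i\<^sub>2 p\<^sub>1 p\<^sub>2. is_direct_sum C A B S i\<^sub>1 i\<^sub>2 p\<^sub>1 p\<^sub>2"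
proof -
  have "\<forall>p \<in> P. \<exists>S i\<^sub>1 i\<^sub>2 p\<^sub>1 p\<^sub>2. is_biproduct k (space_at A p) (space_at B p) S i\<^sub>1 i\<^sub>2 p\<^sub>1 p\<^sub>2"
    using biproduct_exists[OF field_axioms inf space_at_module[OF A] space_at_module[OF B]] by blast
  then obtain T I J R S where
    "\<forall>p \<in> P. is_biproduct k (space_at A p) (space_at B p) (T p) (I p) (J p) (R p) (S p)"
    by metis
  then have T: "\<And>p. p \<in> P \<Longrightarrow> module k (T p)"
    and I: "\<And>p. p \<in> P \<Longrightarrow> I p \<in> linear_maps k (space_at A p) (T p)"
    and J: "\<And>p. p \<in> P \<Longrightarrow> J p \<in> linear_maps k (space_at B p) (T p)"
    and R: "\<And>p. p \<in> P \<Longrightarrow> R p \<in> linear_maps k (T p) (space_at A p)"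
    and S: "\<And>p. p \<in> P \<Longrightarrow> S p \<in> linear_maps k (T p) (space_at B p)"
    and RI: "\<And>p x. \<lbrakk>p \<in> P; x \<in> carrier (space_at A p)\<rbrakk> \<Longrightarrow> R p (I p x) = x"
    and SI: "\<And>p x. \<lbrakk>p \<in> P; x \<in> carrier (space_at A p)\<rbrakk> \<Longrightarrow> S p (I p x) = \<zero>\<^bsub>space_at B p\<^esub>"
    and RJ: "\<And>p y. \<lbrakk>p \<in> P; y \<in> carrier (space_at B p)\<rbrakk> \<Longrightarrow> R p (J p y) = \<zero>\<^bsub>space_at A p\<^esub>"
    and SJ: "\<And>p y. \<lbrakk>p \<in> P; y \<in> carrier (space_at B p)\<rbrakk> \<Longrightarrow> S p (J p y) = y"
    and IR_JS: "\<And>p t. \<lbrakk>p \<in> P; t \<in> carrier (T p)\<rbrakk> \<Longrightarrow> I p (R p t) \<oplus>\<^bsub>T p\<^esub> J p (S p t) = t"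
    unfolding is_biproduct_def by simp_all
  note closed = linear_maps_closed[OF I] linear_maps_closed[OF J]
    linear_maps_closed[OF R] linear_maps_closed[OF S] edge_map_closed[OF A] edge_map_closed[OF B]
  \<comment> \<open>The map along an arrow is block diagonal.\<close>
  define M where "M e = (\<lambda>t \<in> carrier (T (src e)).
      I (tgt e) (edge_map A e (R (src e) t)) \<oplus>\<^bsub>T (tgt e)\<^esub> J (tgt e) (edge_map B e (S (src e) t)))" for e
  have M: "M e \<in> linear_maps k (T (src e)) (T (tgt e))" if e: "e \<in> E" for e
  proof -
    note s = src_in_P[OF e] and t = tgt_in_P[OF e]
    have "(\<lambda>x \<in> carrier (T (src e)). I (tgt e) ((\<lambda>x \<in> carrier (T (src e)). edge_map A e (R (src e) x)) x))
        \<in> linear_maps k (T (src e)) (T (tgt e))"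
      by (intro linear_maps_compose[OF T[OF s] _ I[OF t]]
          linear_maps_compose[OF T[OF s] R[OF s] edge_map_linear[OF A e]])
    moreover have "(\<lambda>x \<in> carrier (T (src e)). J (tgt e) ((\<lambda>x \<in> carrier (T (src e)). edge_map B e (S (src e) x)) x))
        \<in> linear_maps k (T (src e)) (T (tgt e))"
      by (intro linear_maps_compose[OF T[OF s] _ J[OF t]]
          linear_maps_compose[OF T[OF s] S[OF s] edge_map_linear[OF B e]])
    ultimately show ?thesis
      by (rule linear_maps_cong[OF _ _ linear_maps_sum[OF T[OF s] T[OF t]], rotated 2])
        (simp_all add: M_def)
  qed
  obtain W :: "('k, 'v, 'q, 'a) nrep" where W: "W \<in> nreps k n Q"
    and W_space: "\<And>p. p \<in> P \<Longrightarrow> space_at W p = T p"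
    and W_map: "\<And>e. e \<in> E \<Longrightarrow> edge_map W e = M e"
    using nreps_build[of T M, OF T M] by metis
  have I_comm: "I (tgt e) (edge_map A e x) = M e (I (src e) x)"
    if "e \<in> E" "x \<in> carrier (space_at A (src e))" for e x
  proof -
    note p = src_in_P[OF that(1)] tgt_in_P[OF that(1)]
    interpret T: module k "T (tgt e)" using T[OF p(2)] .
    show ?thesis
      using that p linear_maps_zero[OF space_at_module[OF B p(2)] T[OF p(2)] J[OF p(2)]]
      by (simp add: M_def closed RI SI edge_map_zero[OF B])
  qed
  have J_comm: "J (tgt e) (edge_map B e x) = M e (J (src e) x)"
    if "e \<in> E" "x \<in> carrier (space_at B (src e))" for e x
  proof -
    note p = src_in_P[OF that(1)] tgt_in_P[OF that(1)]
    interpret T: module k "T (tgt e)" using T[OF p(2)] .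
    show ?thesis
      using that p linear_maps_zero[OF space_at_module[OF A p(2)] T[OF p(2)] I[OF p(2)]]
      by (simp add: M_def closed RJ SJ edge_map_zero[OF A])
  qed
  have R_comm: "R (tgt e) (M e x) = edge_map A e (R (src e) x)"
    if "e \<in> E" "x \<in> carrier (T (src e))" for e x
  proof -
    note p = src_in_P[OF that(1)] tgt_in_P[OF that(1)]
    interpret A: module k "space_at A (tgt e)" using space_at_module[OF A p(2)] .
    show ?thesis
      using that p by (simp add: M_def closed linear_maps_add[OF R] RI RJ)
  qed
  have S_comm: "S (tgt e) (M e x) = edge_map B e (S (src e) x)"
    if "e \<in> E" "x \<in> carrier (T (src e))" for e x
  proof -
    note p = src_in_P[OF that(1)] tgt_in_P[OF that(1)]
    interpret B: module k "space_at B (tgt e)" using space_at_module[OF B p(2)] .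
    show ?thesis
      using that p by (simp add: M_def closed linear_maps_add[OF S] SI SJ)
  qed
  obtain i\<^sub>1 where i\<^sub>1: "i\<^sub>1 \<in> nrep_hom k n Q A W" "\<And>p. p \<in> P \<Longrightarrow> cmpt i\<^sub>1 p = I p"
    by (rule nrep_hom_exists[of I A W]) (auto simp: W_space W_map I I_comm)
  obtain i\<^sub>2 where i\<^sub>2: "i\<^sub>2 \<in> nrep_hom k n Q B W" "\<And>p. p \<in> P \<Longrightarrow> cmpt i\<^sub>2 p = J p"
    by (rule nrep_hom_exists[of J B W]) (auto simp: W_space W_map J J_comm)
  obtain p\<^sub>1 where p\<^sub>1: "p\<^sub>1 \<in> nrep_hom k n Q W A" "\<And>p. p \<in> P \<Longrightarrow> cmpt p\<^sub>1 p = R p"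
    by (rule nrep_hom_exists[of R W A]) (auto simp: W_space W_map R R_comm src_in_P)
  obtain p\<^sub>2 where p\<^sub>2: "p\<^sub>2 \<in> nrep_hom k n Q W B" "\<And>p. p \<in> P \<Longrightarrow> cmpt p\<^sub>2 p = S p"
    by (rule nrep_hom_exists[of S W B]) (auto simp: W_space W_map S S_comm src_in_P)
  note homs = i\<^sub>1(1) i\<^sub>2(1) p\<^sub>1(1) p\<^sub>2(1) Cmp_hom[OF A i\<^sub>1(1)] Cmp_hom[OF B i\<^sub>2(1)]
    Cmp_hom[OF W p\<^sub>1(1)] Cmp_hom[OF W p\<^sub>2(1)]
    Idn_hom[OF A] Idn_hom[OF B] Idn_hom[OF W] zero_hom[OF A B] zero_hom[OF B A] add_hom[OF W W]
  note eval = i\<^sub>1(2) i\<^sub>2(2) p\<^sub>1(2) p\<^sub>2(2) W_space cmpt_Cmp cmpt_Idn cmpt_zero cmpt_add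
    RI SI RJ SJ IR_JS
  have "Cmp C A W A p\<^sub>1 i\<^sub>1 = Idn C A"
    by (rule nrep_hom_eqI[of _ A A]) (simp_all add: homs eval)
  moreover have "Cmp C B W B p\<^sub>2 i\<^sub>2 = Idn C B"
    by (rule nrep_hom_eqI[of _ B B]) (simp_all add: homs eval)
  moreover have "Cmp C A W B p\<^sub>2 i\<^sub>1 = \<zero>\<^bsub>Hom C A B\<^esub>"
    by (rule nrep_hom_eqI[of _ A B]) (simp_all add: homs eval)
  moreover have "Cmp C B W A p\<^sub>1 i\<^sub>2 = \<zero>\<^bsub>Hom C B A\<^esub>"
    by (rule nrep_hom_eqI[of _ B A]) (simp_all add: homs eval)
  moreover have "Cmp C W A W i\<^sub>1 p\<^sub>1 \<oplus>\<^bsub>Hom C W W\<^esub> Cmp C W B W i\<^sub>2 p\<^sub>2 = Idn C W"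
    by (rule nrep_hom_eqI[of _ W W]) (simp_all add: homs eval)
  ultimately have "is_direct_sum C A B W i\<^sub>1 i\<^sub>2 p\<^sub>1 p\<^sub>2"
    unfolding is_direct_sum_def nRep_simps using W homs by simp
  then show ?thesis by blast
qed

section \<open>Kernels, cokernels and the canonical decomposition\<close>

text \<open>
  The factorisation through \<open>\<kappa>\<close> is chosen at each vertex; it commutes with the arrow maps
  because \<open>\<kappa>\<close> does and is pointwise injective.
\<close>

lemma is_kernelI:
  fixes A B K :: "('k, 'v, 'q, 'a) nrep"
  assumes A: "A \<in> nreps k n Q" and B: "B \<in> nreps k n Q" and K: "K \<in> nreps k n Q"
    and f: "f \<in> nrep_hom k n Q A B" and \<kappa>: "\<kappa> \<in> nrep_hom k n Q K A"
    and inj: "\<And>p. p \<in> P \<Longrightarrow> inj_on (cmpt \<kappa> p) (carrier (space_at K p))"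
    and im: "\<And>p. p \<in> P \<Longrightarrow> cmpt \<kappa> p ` carrier (space_at K p) =
      {x \<in> carrier (space_at A p). cmpt f p x = \<zero>\<^bsub>space_at B p\<^esub>}"
  shows "is_kernel C A B f K \<kappa>"
  unfolding is_kernel_def nRep_simps
proof (intro conjI ballI impI K \<kappa>)
  show "Cmp C K A B f \<kappa> = \<zero>\<^bsub>Hom C K B\<^esub>"
  proof (rule nrep_hom_eqI[OF Cmp_hom[OF K \<kappa> f] zero_hom[OF K B]])
    fix p x assume p: "p \<in> P" and x: "x \<in> carrier (space_at K p)"
    then have "cmpt f p (cmpt \<kappa> p x) = \<zero>\<^bsub>space_at B p\<^esub>"
      using im by blast
    then show "cmpt (Cmp C K A B f \<kappa>) p x = cmpt \<zero>\<^bsub>Hom C K B\<^esub> p x"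
      using p x by (simp add: cmpt_Cmp cmpt_zero)
  qed
next
  fix T :: "('k, 'v, 'q, 'a) nrep" and g
  assume T: "T \<in> nreps k n Q" and g: "g \<in> nrep_hom k n Q T A"
    and fg: "Cmp C T A B f g = \<zero>\<^bsub>Hom C T B\<^esub>"
  have "\<exists>u \<in> linear_maps k (space_at T p) (space_at K p).
      \<forall>x \<in> carrier (space_at T p). cmpt \<kappa> p (u x) = cmpt g p x" if p: "p \<in> P" for p
  proof (rule linear_maps_factor_inj[OF space_at_module[OF T p] space_at_module[OF K p]
        nrep_hom_linear[OF \<kappa> p] inj[OF p] nrep_hom_linear[OF g p]])
    have "cmpt f p (cmpt g p x) = \<zero>\<^bsub>space_at B p\<^esub>" if x: "x \<in> carrier (space_at T p)" for x
      using arg_cong[OF fg, of "\<lambda>h. cmpt h p x"] p x by (simp add: cmpt_Cmp cmpt_zero)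
    then show "cmpt g p ` carrier (space_at T p) \<subseteq> cmpt \<kappa> p ` carrier (space_at K p)"
      using nrep_hom_closed[OF g p] by (auto simp: im[OF p])
  qed
  then obtain U where U: "\<And>p. p \<in> P \<Longrightarrow> U p \<in> linear_maps k (space_at T p) (space_at K p)"
    and \<kappa>U: "\<And>p x. \<lbrakk>p \<in> P; x \<in> carrier (space_at T p)\<rbrakk> \<Longrightarrow> cmpt \<kappa> p (U p x) = cmpt g p x"
    by metis
  have U_comm: "U (tgt e) (edge_map T e x) = edge_map K e (U (src e) x)"
    if e: "e \<in> E" and x: "x \<in> carrier (space_at T (src e))" for e x
  proof (rule inj_onD[OF inj[OF tgt_in_P[OF e]]])
    note Ux = linear_maps_closed[OF U[OF src_in_P[OF e]] x]
    show "cmpt \<kappa> (tgt e) (U (tgt e) (edge_map T e x)) = cmpt \<kappa> (tgt e) (edge_map K e (U (src e) x))"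
      using e x src_in_P tgt_in_P edge_map_closed[OF T e x]
      by (simp add: \<kappa>U nrep_hom_commute[OF g] nrep_hom_commute[OF \<kappa> e Ux])
    show "U (tgt e) (edge_map T e x) \<in> carrier (space_at K (tgt e))"
      using linear_maps_closed[OF U[OF tgt_in_P[OF e]] edge_map_closed[OF T e x]] .
    show "edge_map K e (U (src e) x) \<in> carrier (space_at K (tgt e))"
      using edge_map_closed[OF K e Ux] .
  qed
  obtain u where u: "u \<in> nrep_hom k n Q T K" and cmpt_u: "\<And>p. p \<in> P \<Longrightarrow> cmpt u p = U p"
    using nrep_hom_exists[of U T K, OF U U_comm] by metis
  show "\<exists>!u. u \<in> nrep_hom k n Q T K \<and> Cmp C T K A \<kappa> u = g"
  proof (rule ex1I)
    show "u \<in> nrep_hom k n Q T K \<and> Cmp C T K A \<kappa> u = g"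
      using u nrep_hom_eqI[OF Cmp_hom[OF T u \<kappa>] g] by (simp add: cmpt_Cmp cmpt_u \<kappa>U)
    fix v assume v: "v \<in> nrep_hom k n Q T K \<and> Cmp C T K A \<kappa> v = g"
    show "v = u"
    proof (rule nrep_hom_eqI[OF conjunct1[OF v] u])
      fix p x assume p: "p \<in> P" and x: "x \<in> carrier (space_at T p)"
      have "cmpt \<kappa> p (cmpt v p x) = cmpt \<kappa> p (cmpt u p x)"
        using v p x cmpt_Cmp[of p x T K A \<kappa> v] by (simp add: cmpt_u \<kappa>U)
      then show "cmpt v p x = cmpt u p x"
        using inj_onD[OF inj[OF p]] nrep_hom_closed[OF conjunct1[OF v] p x] nrep_hom_closed[OF u p x]
        by blast
    qed
  qed
qed

text \<open>Dually, the factorisation through \<open>c\<close> commutes with the arrow maps because \<open>c\<close> is pointwise onto.\<close>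

lemma is_cokernelI:
  fixes A B D :: "('k, 'v, 'q, 'a) nrep"
  assumes A: "A \<in> nreps k n Q" and B: "B \<in> nreps k n Q" and D: "D \<in> nreps k n Q"
    and f: "f \<in> nrep_hom k n Q A B" and c: "c \<in> nrep_hom k n Q B D"
    and surj: "\<And>p. p \<in> P \<Longrightarrow> cmpt c p ` carrier (space_at B p) = carrier (space_at D p)"
    and ker: "\<And>p. p \<in> P \<Longrightarrow>
      {y \<in> carrier (space_at B p). cmpt c p y = \<zero>\<^bsub>space_at D p\<^esub>} = cmpt f p ` carrier (space_at A p)"
  shows "is_cokernel C A B f D c"
  unfolding is_cokernel_def nRep_simps
proof (intro conjI ballI impI D c)
  show "Cmp C A B D c f = \<zero>\<^bsub>Hom C A D\<^esub>"
  proof (rule nrep_hom_eqI[OF Cmp_hom[OF A f c] zero_hom[OF A D]])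
    fix p x assume p: "p \<in> P" and x: "x \<in> carrier (space_at A p)"
    then have "cmpt c p (cmpt f p x) = \<zero>\<^bsub>space_at D p\<^esub>"
      using ker by blast
    then show "cmpt (Cmp C A B D c f) p x = cmpt \<zero>\<^bsub>Hom C A D\<^esub> p x"
      using p x by (simp add: cmpt_Cmp cmpt_zero)
  qed
next
  fix T :: "('k, 'v, 'q, 'a) nrep" and g
  assume T: "T \<in> nreps k n Q" and g: "g \<in> nrep_hom k n Q B T"
    and gf: "Cmp C A B T g f = \<zero>\<^bsub>Hom C A T\<^esub>"
  have "\<exists>u \<in> linear_maps k (space_at D p) (space_at T p).
      \<forall>x \<in> carrier (space_at B p). u (cmpt c p x) = cmpt g p x" if p: "p \<in> P" for p
  proof (rule linear_maps_factor_surj[OF space_at_module[OF B p] space_at_module[OF D p]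
        space_at_module[OF T p] nrep_hom_linear[OF c p] surj[OF p] nrep_hom_linear[OF g p]])
    fix y assume "y \<in> carrier (space_at B p)" "cmpt c p y = \<zero>\<^bsub>space_at D p\<^esub>"
    then obtain x where "x \<in> carrier (space_at A p)" "y = cmpt f p x"
      using ker[OF p] by blast
    then show "cmpt g p y = \<zero>\<^bsub>space_at T p\<^esub>"
      using arg_cong[OF gf, of "\<lambda>h. cmpt h p x"] p by (simp add: cmpt_Cmp cmpt_zero)
  qed
  then obtain U where U: "\<And>p. p \<in> P \<Longrightarrow> U p \<in> linear_maps k (space_at D p) (space_at T p)"
    and Uc: "\<And>p x. \<lbrakk>p \<in> P; x \<in> carrier (space_at B p)\<rbrakk> \<Longrightarrow> U p (cmpt c p x) = cmpt g p x"
    by metis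
  have U_comm: "U (tgt e) (edge_map D e y) = edge_map T e (U (src e) y)"
    if e: "e \<in> E" and y: "y \<in> carrier (space_at D (src e))" for e y
  proof -
    obtain x where x: "x \<in> carrier (space_at B (src e))" "y = cmpt c (src e) x"
      using surj[OF src_in_P[OF e]] y by blast
    have "edge_map D e y = cmpt c (tgt e) (edge_map B e x)"
      using nrep_hom_commute[OF c e x(1)] x(2) by simp
    then show ?thesis
      using x e src_in_P tgt_in_P edge_map_closed[OF B e x(1)]
      by (simp add: Uc nrep_hom_commute[OF g e x(1)])
  qed
  obtain u where u: "u \<in> nrep_hom k n Q D T" and cmpt_u: "\<And>p. p \<in> P \<Longrightarrow> cmpt u p = U p"
    using nrep_hom_exists[of U D T, OF U U_comm] by metis
  show "\<exists>!u. u \<in> nrep_hom k n Q D T \<and> Cmp C B D T u c = g"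
  proof (rule ex1I)
    show "u \<in> nrep_hom k n Q D T \<and> Cmp C B D T u c = g"
      using u nrep_hom_eqI[OF Cmp_hom[OF B c u] g] by (simp add: cmpt_Cmp cmpt_u Uc)
    fix v assume v: "v \<in> nrep_hom k n Q D T \<and> Cmp C B D T v c = g"
    show "v = u"
    proof (rule nrep_hom_eqI[OF conjunct1[OF v] u])
      fix p y assume p: "p \<in> P" and "y \<in> carrier (space_at D p)"
      then obtain x where x: "x \<in> carrier (space_at B p)" "y = cmpt c p x"
        using surj[OF p] by blast
      then show "cmpt v p y = cmpt u p y"
        using v p cmpt_Cmp[of p x B D T v c] by (simp add: cmpt_u Uc)
    qed
  qed
qed

lemma subrep_exists:
  fixes A :: "('k, 'v, 'q, 'a) nrep"
  assumes A: "A \<in> nreps k n Q"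
    and sub: "\<And>p. p \<in> P \<Longrightarrow> submodule (U p) k (space_at A p)"
    and stable: "\<And>e x. \<lbrakk>e \<in> E; x \<in> U (src e)\<rbrakk> \<Longrightarrow> edge_map A e x \<in> U (tgt e)"
  obtains K \<kappa> where "K \<in> nreps k n Q" "\<kappa> \<in> nrep_hom k n Q K A"
    "\<And>p. p \<in> P \<Longrightarrow> inj_on (cmpt \<kappa> p) (carrier (space_at K p))"
    "\<And>p. p \<in> P \<Longrightarrow> cmpt \<kappa> p ` carrier (space_at K p) = U p"
proof -
  define S where "S p = (space_at A p)\<lparr>carrier := U p\<rparr>" for p
  have S: "module k (S p)" if "p \<in> P" for p
    unfolding S_def using submodule.submodule_is_module[OF sub[OF that] space_at_module[OF A that]] .
  have subset: "x \<in> carrier (space_at A p)" if "p \<in> P" "x \<in> U p" for p x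
    using module.submoduleE(1)[OF space_at_module[OF A that(1)] sub[OF that(1)]] that(2) by blast
  have "restrict (edge_map A e) (U (src e)) \<in> linear_maps k (S (src e)) (S (tgt e))" if e: "e \<in> E" for e
    using module.submoduleE(4,5)[OF space_at_module[OF A] sub] subset[OF src_in_P[OF e]] src_in_P[OF e]
      stable[OF e] linear_maps_add[OF edge_map_linear[OF A e]]
      linear_maps_smult[OF edge_map_linear[OF A e]]
    by (intro linear_mapsI) (auto simp: S_def)
  then obtain K :: "('k, 'v, 'q, 'a) nrep" where K: "K \<in> nreps k n Q"
    "\<And>p. p \<in> P \<Longrightarrow> space_at K p = S p" "\<And>e. e \<in> E \<Longrightarrow> edge_map K e = restrict (edge_map A e) (U (src e))"
    using nreps_build[of S "\<lambda>e. restrict (edge_map A e) (U (src e))", OF S] by metis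
  have "(\<lambda>x \<in> U p. x) \<in> linear_maps k (S p) (space_at A p)" if p: "p \<in> P" for p
    using module.submoduleE(4,5)[OF space_at_module[OF A] sub] subset p
    by (intro linear_mapsI) (auto simp: S_def)
  then obtain \<kappa> where \<kappa>: "\<kappa> \<in> nrep_hom k n Q K A" "\<And>p. p \<in> P \<Longrightarrow> cmpt \<kappa> p = (\<lambda>x \<in> U p. x)"
    by (rule_tac nrep_hom_exists[of "\<lambda>p. \<lambda>x \<in> U p. x" K A])
      (auto simp: K S_def src_in_P tgt_in_P stable)
  show ?thesis
    by (rule that[OF K(1) \<kappa>(1)]) (auto simp: \<kappa> K S_def inj_on_def)
qed

lemma quotient_rep_exists:
  fixes A :: "('k, 'v, 'q, 'a) nrep"
  assumes A: "A \<in> nreps k n Q"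
    and sub: "\<And>p. p \<in> P \<Longrightarrow> submodule (U p) k (space_at A p)"
    and stable: "\<And>e x. \<lbrakk>e \<in> E; x \<in> U (src e)\<rbrakk> \<Longrightarrow> edge_map A e x \<in> U (tgt e)"
  shows "\<exists>D c. D \<in> nreps k n Q \<and> c \<in> nrep_hom k n Q A D \<and>
    (\<forall>p \<in> P. cmpt c p ` carrier (space_at A p) = carrier (space_at D p)) \<and>
    (\<forall>p \<in> P. {x \<in> carrier (space_at A p). cmpt c p x = \<zero>\<^bsub>space_at D p\<^esub>} = U p)"
proof -
  have "\<forall>p \<in> P. \<exists>(S :: ('k, 'v) module) q. module k S \<and> q \<in> linear_maps k (space_at A p) S \<and>
     q ` carrier (space_at A p) = carrier S \<and> (\<forall>x \<in> carrier (space_at A p). q x = \<zero>\<^bsub>S\<^esub> \<longleftrightarrow> x \<in> U p)"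
    using quotient_module_exists[OF space_at_module[OF A] sub] by blast
  then obtain S :: "nat \<times> 'q \<Rightarrow> ('k, 'v) module" and q where
    *: "\<forall>p \<in> P. module k (S p) \<and> q p \<in> linear_maps k (space_at A p) (S p) \<and>
     q p ` carrier (space_at A p) = carrier (S p) \<and>
     (\<forall>x \<in> carrier (space_at A p). q p x = \<zero>\<^bsub>S p\<^esub> \<longleftrightarrow> x \<in> U p)"
    by metis
  then have S: "\<And>p. p \<in> P \<Longrightarrow> module k (S p)"
    and q: "\<And>p. p \<in> P \<Longrightarrow> q p \<in> linear_maps k (space_at A p) (S p)"
    and surj: "\<And>p. p \<in> P \<Longrightarrow> q p ` carrier (space_at A p) = carrier (S p)"
    and ker: "\<And>p x. \<lbrakk>p \<in> P; x \<in> carrier (space_at A p)\<rbrakk> \<Longrightarrow> q p x = \<zero>\<^bsub>S p\<^esub> \<longleftrightarrow> x \<in> U p"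
    by simp_all
  have "\<exists>u \<in> linear_maps k (S (src e)) (S (tgt e)). \<forall>x \<in> carrier (space_at A (src e)).
      u (q (src e) x) = (\<lambda>x \<in> carrier (space_at A (src e)). q (tgt e) (edge_map A e x)) x"
    if e: "e \<in> E" for e
  proof -
    note s = src_in_P[OF e] and t = tgt_in_P[OF e]
    show ?thesis
      by (rule linear_maps_factor_surj[OF space_at_module[OF A s] S[OF s] S[OF t] q[OF s] surj[OF s]
            linear_maps_compose[OF space_at_module[OF A s] edge_map_linear[OF A e] q[OF t]]])
        (simp add: ker s t stable[OF e] edge_map_closed[OF A e])
  qed
  then obtain M where M: "\<And>e. e \<in> E \<Longrightarrow> M e \<in> linear_maps k (S (src e)) (S (tgt e))"
    and Mq: "\<And>e x. \<lbrakk>e \<in> E; x \<in> carrier (space_at A (src e))\<rbrakk>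
      \<Longrightarrow> M e (q (src e) x) = (\<lambda>x \<in> carrier (space_at A (src e)). q (tgt e) (edge_map A e x)) x"
    by metis
  obtain D :: "('k, 'v, 'q, 'a) nrep" where D: "D \<in> nreps k n Q"
    "\<And>p. p \<in> P \<Longrightarrow> space_at D p = S p" "\<And>e. e \<in> E \<Longrightarrow> edge_map D e = M e"
    using nreps_build[of S M, OF S M] by metis
  obtain c where c: "c \<in> nrep_hom k n Q A D" "\<And>p. p \<in> P \<Longrightarrow> cmpt c p = q p"
    by (rule nrep_hom_exists[of q A D]) (auto simp: D q Mq)
  show ?thesis
  proof (intro exI conjI ballI D(1) c(1))
    fix p assume p: "p \<in> P"
    show "cmpt c p ` carrier (space_at A p) = carrier (space_at D p)"
      using surj p by (simp add: c D)
    have "U p \<subseteq> carrier (space_at A p)"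
      by (rule module.submoduleE(1)[OF space_at_module[OF A p] sub[OF p]])
    then show "{x \<in> carrier (space_at A p). cmpt c p x = \<zero>\<^bsub>space_at D p\<^esub>} = U p"
      using ker[OF p] p by (auto simp: c D)
  qed (rule D(1) c(1))+
qed

lemma canonical_decomposition_exists:
  fixes A B :: "('k, 'v, 'q, 'a) nrep"
  assumes A: "A \<in> nreps k n Q" and B: "B \<in> nreps k n Q" and f: "f \<in> nrep_hom k n Q A B"
  shows "has_canonical_decomposition C A B f"
proof -
  define Ker where "Ker p = {x \<in> carrier (space_at A p). cmpt f p x = \<zero>\<^bsub>space_at B p\<^esub>}" for p
  define Im where "Im p = cmpt f p ` carrier (space_at A p)" for p
  have sub_ker: "submodule (Ker p) k (space_at A p)" if "p \<in> P" for p
    unfolding Ker_def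
    by (rule submodule_kernel[OF space_at_module[OF A that] space_at_module[OF B that]
          nrep_hom_linear[OF f that]])
  have sub_im: "submodule (Im p) k (space_at B p)" if "p \<in> P" for p
    unfolding Im_def
    by (rule submodule_image[OF space_at_module[OF A that] space_at_module[OF B that]
          nrep_hom_linear[OF f that]])
  have stable_ker: "edge_map A e x \<in> Ker (tgt e)" if "e \<in> E" "x \<in> Ker (src e)" for e x
    using that by (simp add: Ker_def edge_map_closed[OF A] nrep_hom_commute[OF f] edge_map_zero[OF B])
  have stable_im: "edge_map B e y \<in> Im (tgt e)" if e: "e \<in> E" and y: "y \<in> Im (src e)" for e y
  proof -
    obtain x where x: "x \<in> carrier (space_at A (src e))" "y = cmpt f (src e) x"
      using y by (auto simp: Im_def)
    then have "edge_map B e y = cmpt f (tgt e) (edge_map A e x)"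
      using nrep_hom_commute[OF f e] by simp
    then show ?thesis
      using edge_map_closed[OF A e x(1)] by (simp add: Im_def)
  qed
  obtain K \<kappa> where K: "K \<in> nreps k n Q" "\<kappa> \<in> nrep_hom k n Q K A"
    "\<And>p. p \<in> P \<Longrightarrow> inj_on (cmpt \<kappa> p) (carrier (space_at K p))"
    "\<And>p. p \<in> P \<Longrightarrow> cmpt \<kappa> p ` carrier (space_at K p) = Ker p"
    using subrep_exists[OF A, of Ker, OF sub_ker stable_ker] by metis
  obtain I j where I: "I \<in> nreps k n Q" "j \<in> nrep_hom k n Q I B"
    "\<And>p. p \<in> P \<Longrightarrow> inj_on (cmpt j p) (carrier (space_at I p))"
    "\<And>p. p \<in> P \<Longrightarrow> cmpt j p ` carrier (space_at I p) = Im p"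
    using subrep_exists[OF B, of Im, OF sub_im stable_im] by metis
  have "\<exists>D c. D \<in> nreps k n Q \<and> c \<in> nrep_hom k n Q B D \<and>
      (\<forall>p \<in> P. cmpt c p ` carrier (space_at B p) = carrier (space_at D p)) \<and>
      (\<forall>p \<in> P. {y \<in> carrier (space_at B p). cmpt c p y = \<zero>\<^bsub>space_at D p\<^esub>} = Im p)"
    by (rule quotient_rep_exists[OF B, of Im, OF sub_im stable_im])
  then obtain D c where D: "D \<in> nreps k n Q" "c \<in> nrep_hom k n Q B D"
    "\<forall>p \<in> P. cmpt c p ` carrier (space_at B p) = carrier (space_at D p)"
    "\<forall>p \<in> P. {y \<in> carrier (space_at B p). cmpt c p y = \<zero>\<^bsub>space_at D p\<^esub>} = Im p"
    by (elim exE conjE)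
  have ker_f: "is_kernel C A B f K \<kappa>"
    by (rule is_kernelI[OF A B K(1) f K(2,3)]) (simp_all add: K(4) Ker_def)
  \<comment> \<open>The zero set of \<open>c\<close> is the common image of \<open>f\<close> and \<open>j\<close>.\<close>
  have coker_f: "is_cokernel C A B f D c"
    by (rule is_cokernelI[OF A B D(1) f D(2) bspec[OF D(3)]]) (simp_all add: D(4) Im_def)
  have ker_c: "is_kernel C B D c I j"
    by (rule is_kernelI[OF B D(1) I(1) D(2) I(2,3)]) (simp_all add: D(4) I(4))
  have "Cmp C A B D c f = \<zero>\<^bsub>Hom C A D\<^esub>"
    using coker_f by (simp add: is_cokernel_def)
  then have "\<exists>!u. u \<in> nrep_hom k n Q A I \<and> Cmp C A I B j u = f"
    using ker_c A f by (simp add: is_kernel_def)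
  then obtain \<iota> where \<iota>: "\<iota> \<in> nrep_hom k n Q A I" "Cmp C A I B j \<iota> = f"
    by blast
  have j\<iota>: "cmpt j p (cmpt \<iota> p x) = cmpt f p x" if "p \<in> P" "x \<in> carrier (space_at A p)" for p x
    using that \<iota>(2) cmpt_Cmp[of p x A I B j \<iota>] by simp
  \<comment> \<open>As \<open>j\<close> is pointwise injective with the image of \<open>f\<close>, \<open>\<iota>\<close> is onto and vanishes exactly where \<open>f\<close> does.\<close>
  have "is_cokernel C K A \<kappa> I \<iota>"
  proof (rule is_cokernelI[OF K(1) A I(1) K(2) \<iota>(1)])
    fix p assume p: "p \<in> P"
    note \<iota>_closed = nrep_hom_closed[OF \<iota>(1) p]
    show "cmpt \<iota> p ` carrier (space_at A p) = carrier (space_at I p)"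
    proof (intro equalityI subsetI)
      fix y assume y: "y \<in> carrier (space_at I p)"
      then obtain x where x: "x \<in> carrier (space_at A p)" "cmpt j p y = cmpt f p x"
        using I(4)[OF p] by (auto simp: Im_def)
      then have "y = cmpt \<iota> p x"
        using inj_onD[OF I(3)[OF p]] j\<iota>[OF p x(1)] \<iota>_closed[OF x(1)] y by metis
      then show "y \<in> cmpt \<iota> p ` carrier (space_at A p)" using x(1) by blast
    qed (use \<iota>_closed in blast)
    have "cmpt \<iota> p x = \<zero>\<^bsub>space_at I p\<^esub> \<longleftrightarrow> cmpt f p x = \<zero>\<^bsub>space_at B p\<^esub>"
      if x: "x \<in> carrier (space_at A p)" for x
    proof -
      interpret I: module k "space_at I p" using space_at_module[OF I(1) p] .
      show ?thesis
        using inj_onD[OF I(3)[OF p]] j\<iota>[OF p x] \<iota>_closed[OF x] I.M.zero_closed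
          nrep_hom_zero[OF I(1) B I(2) p] by metis
    qed
    then show "{x \<in> carrier (space_at A p). cmpt \<iota> p x = \<zero>\<^bsub>space_at I p\<^esub>} =
        cmpt \<kappa> p ` carrier (space_at K p)"
      unfolding K(4)[OF p] Ker_def by blast
  qed
  then show ?thesis
    unfolding has_canonical_decomposition_def using ker_f coker_f ker_c \<iota>(2)
    by (intro exI conjI)
qed

lemma additive_category_nRep:
  assumes "infinite (carrier k)"
  shows "additive_category (C :: ('k, ('k, 'v, 'q, 'a) nrep, nat \<Rightarrow> 'q \<Rightarrow> 'v \<Rightarrow> 'v) category_data)"
  by (intro additive_category.intro additive_category_axioms.intro category_nRep zero_object_exists)
    (simp_all add: module.axioms(2)[OF Hom_module] Cmp_add_left[OF _ _ _ _ _ _ _ one_closed]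
      Cmp_add_right[OF _ _ _ _ _ _ _ one_closed] direct_sum_exists[OF assms])

lemma klinear_category_nRep:
  assumes "infinite (carrier k)"
  shows "klinear_category k (C :: ('k, ('k, 'v, 'q, 'a) nrep, nat \<Rightarrow> 'q \<Rightarrow> 'v \<Rightarrow> 'v) category_data)"
  by (intro klinear_category.intro klinear_category_axioms.intro additive_category_nRep[OF assms] field_axioms)
    (simp_all add: Hom_module Cmp_smult_left Cmp_smult_right)

lemma abelian_category_nRep:
  assumes "infinite (carrier k)"
  shows "abelian_category (C :: ('k, ('k, 'v, 'q, 'a) nrep, nat \<Rightarrow> 'q \<Rightarrow> 'v \<Rightarrow> 'v) category_data)"
  by (intro abelian_category.intro abelian_category_axioms.intro additive_category_nRep[OF assms])
    (simp_all add: canonical_decomposition_exists)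

end

theorem theorem5p3:
  fixes k :: "('k, 'r) ring_scheme"
    and n :: nat
    and Q :: "nat \<Rightarrow> ('q, 'a) pre_digraph"
  assumes "algebraically_closed k"
    and "n \<ge> 2"
    and "\<And>m. m \<in> {1..n} \<Longrightarrow> finite_connected_acyclic (Q m)"
  defines "C \<equiv> (nRep k n Q :: ('k, ('k, 'v, 'q, 'a) nrep, nat \<Rightarrow> 'q \<Rightarrow> 'v \<Rightarrow> 'v) category_data)"
  shows "klinear_category k C \<and> abelian_category C"
proof -
  interpret k: algebraically_closed k by fact
  have "wf_digraph (Q m)" if "m \<in> {1..n}" for m
    using assms(3)[OF that] fin_digraph.axioms(1) unfolding finite_connected_acyclic_def by blast
  then interpret glued_quiver k n Q
    by (intro glued_quiver.intro glued_quiver_axioms.intro k.field_axioms)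
  show ?thesis
    unfolding C_def
    using klinear_category_nRep[OF k.infinite_carrier] abelian_category_nRep[OF k.infinite_carrier] ..
qed

end
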